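(* Let $M \in \{0,1\}^{n\times n}$ and $\Delta \in [0,n]$. Suppose predictions $(\hat v_1,\ldots,\hat v_n)$, with each $\hat v_i\in\{0,1\}^n$, are given such that $EH(\hat v_i,\vec v_i)\le \Delta$ for each online input vector $\vec v_i \in\{0,1\}^n$ ($i=1,\ldots,n$). Then, after preprocessing of $M$ and $(\hat v_1,\ldots,\hat v_n)$ in $O(n^\omega)$ time, each arithmetic (integer) product $M\vec v_i$ can be computed in time $Q(n,\Delta)=O(n(1+\Delta))$ when $\vec v_i$ arrives online. In particular, each Boolean result vector $M\vec v_i$ (Boolean matrix-vector product) can be computed in $O(n(1+\Delta))$ time.
   Context: $\omega$ denotes the matrix multiplication exponent. The extended Hamming distance $EH(s,t)$ of bit strings $s=s_1\ldots s_n,\ t=t_1\ldots t_n\in\{0,1\}^n$ is defined recursively: $EH$ of two empty strings is $0$; otherwise let $\ell\ge 1$ be the largest index such that $s_1=s_2=\cdots=s_\ell$ and $t_1=t_2=\cdots=t_\ell$, and set $EH(s,t) = (s_1+t_1 \bmod 2) + EH(s_{\ell+1}\ldots s_n,\ t_{\ell+1}\ldots t_n)$. In the Online Matrix-Vector (OMv) setting, the matrix $M$ is given for preprocessing, then vectors $\vec v_1,\ldots,\vec v_n$ arrive one at a time and the product $M\vec v_i$ must be output before $\vec v_{i+1}$ is revealed; here the predictions are also available during preprocessing. *)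

theory Defs
  imports Complex_Main "Jordan_Normal_Form.Matrix"
begin

section \<open>Extended Hamming distance\<close>

definition block_len :: "int list \<Rightarrow> int list \<Rightarrow> nat" where
  "block_len s t = (GREATEST l. l \<le> length s \<and> l \<le> length t \<and>
     (\<forall>i<l. s ! i = s ! 0 \<and> t ! i = t ! 0))"

lemma block_len_pos:
  assumes "s \<noteq> []" and "t \<noteq> []"
  shows "1 \<le> block_len s t"
proof -
  let ?P = "\<lambda>l. l \<le> length s \<and> l \<le> length t \<and> (\<forall>i<l. s ! i = s ! 0 \<and> t ! i = t ! 0)"
  have "?P 1" using assms by (auto simp: Suc_le_eq)
  then show ?thesis
    unfolding block_len_def by (rule Greatest_le_nat[where b = "length s"]) auto
qed

text \<open>Only applied to 0/1 lists of equal length.\<close>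

function EH :: "int list \<Rightarrow> int list \<Rightarrow> int" where
  "EH s t = (if s = [] \<or> t = [] then 0
     else (s ! 0 + t ! 0) mod 2 +
       EH (drop (block_len s t) s) (drop (block_len s t) t))"
  by pat_completeness auto
termination
proof (relation "measure (\<lambda>(s, t). length s)", goal_cases)
  case (2 s t)
  then show ?case using block_len_pos[of s t] by (cases s) auto
qed simp

declare EH.simps [simp del]


section \<open>Word RAM\<close>

text \<open>
  The machine is a unit-cost word RAM with structured control flow. Its memory consists of
  integer registers and zero-based integer arrays, both named by natural numbers; a program
  mentions only finitely many of them. (Keeping several arrays side by side in one linear memory
  and replacing jumps by structured control changes running times by constant factors only.)
\<close>

datatype operand = Const int | Reg nat

datatype binop = Add | Sub | Mul | Div | Mod | And | Or | Xor | Less | Equal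

datatype com =
    Skip
  | Op nat binop operand operand  \<comment> \<open>\<open>r := a \<circ> b\<close>\<close>
  | Load nat nat operand          \<comment> \<open>\<open>r := A[i]\<close>\<close>
  | Store nat operand operand     \<comment> \<open>\<open>A[i] := a\<close>\<close>
  | Seq com com
  | Cond operand com com          \<comment> \<open>a nonzero value means true\<close>
  | While operand com

record ram_state =
  reg :: "nat \<Rightarrow> int"
  arr :: "nat \<Rightarrow> nat \<Rightarrow> int"

fun opval :: "ram_state \<Rightarrow> operand \<Rightarrow> int" where
  "opval \<sigma> (Const c) = c"
| "opval \<sigma> (Reg r) = reg \<sigma> r"

fun apply_binop :: "binop \<Rightarrow> int \<Rightarrow> int \<Rightarrow> int" where
  "apply_binop Add a b = a + b"
| "apply_binop Sub a b = a - b"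
| "apply_binop Mul a b = a * b"
| "apply_binop Div a b = a div b"
| "apply_binop Mod a b = a mod b"
| "apply_binop And a b = Bit_Operations.and a b"
| "apply_binop Or a b = Bit_Operations.or a b"
| "apply_binop Xor a b = Bit_Operations.xor a b"
| "apply_binop Less a b = of_bool (a < b)"
| "apply_binop Equal a b = of_bool (a = b)"

text \<open>
  \<open>exec W c \<sigma> t \<sigma>'\<close>: started in \<open>\<sigma>\<close>, program \<open>c\<close> halts in \<open>\<sigma>'\<close> after exactly \<open>t\<close> steps. Every
  value written and every address used has to lie in the word range given by \<open>W\<close>; otherwise
  the machine is stuck and there is no derivation.
\<close>

inductive exec :: "int \<Rightarrow> com \<Rightarrow> ram_state \<Rightarrow> nat \<Rightarrow> ram_state \<Rightarrow> bool" for W :: int where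
  exec_Skip: "exec W Skip \<sigma> 1 \<sigma>"
| exec_Op: "x = apply_binop f (opval \<sigma> a) (opval \<sigma> b) \<Longrightarrow> \<bar>x\<bar> \<le> W \<Longrightarrow>
    exec W (Op r f a b) \<sigma> 1 (\<sigma>\<lparr>reg := (reg \<sigma>)(r := x)\<rparr>)"
| exec_Load: "0 \<le> opval \<sigma> i \<Longrightarrow> opval \<sigma> i \<le> W \<Longrightarrow> x = arr \<sigma> A (nat (opval \<sigma> i)) \<Longrightarrow> \<bar>x\<bar> \<le> W \<Longrightarrow>
    exec W (Load r A i) \<sigma> 1 (\<sigma>\<lparr>reg := (reg \<sigma>)(r := x)\<rparr>)"
| exec_Store: "0 \<le> opval \<sigma> i \<Longrightarrow> opval \<sigma> i \<le> W \<Longrightarrow> x = opval \<sigma> a \<Longrightarrow> \<bar>x\<bar> \<le> W \<Longrightarrow>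
    exec W (Store A i a) \<sigma> 1 (\<sigma>\<lparr>arr := (arr \<sigma>)(A := (arr \<sigma> A)(nat (opval \<sigma> i) := x))\<rparr>)"
| exec_Seq: "exec W c \<sigma> t \<sigma>' \<Longrightarrow> exec W d \<sigma>' u \<sigma>'' \<Longrightarrow> exec W (Seq c d) \<sigma> (t + u) \<sigma>''"
| exec_CondT: "opval \<sigma> a \<noteq> 0 \<Longrightarrow> exec W c \<sigma> t \<sigma>' \<Longrightarrow> exec W (Cond a c d) \<sigma> (t + 1) \<sigma>'"
| exec_CondF: "opval \<sigma> a = 0 \<Longrightarrow> exec W d \<sigma> t \<sigma>' \<Longrightarrow> exec W (Cond a c d) \<sigma> (t + 1) \<sigma>'"
| exec_WhileF: "opval \<sigma> a = 0 \<Longrightarrow> exec W (While a c) \<sigma> 1 \<sigma>"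
| exec_WhileT: "opval \<sigma> a \<noteq> 0 \<Longrightarrow> exec W c \<sigma> t \<sigma>' \<Longrightarrow> exec W (While a c) \<sigma>' u \<sigma>'' \<Longrightarrow>
    exec W (While a c) \<sigma> (t + u + 1) \<sigma>''"

text \<open>
  Words of \<open>O(log n)\<close> bits: on inputs of dimension \<open>n\<close> a program has words of absolute value at
  most \<open>(n + 2) ^ k\<close>, where \<open>k\<close> is a constant belonging to the program. Without such a bound,
  unit-cost arithmetic could multiply whole matrices packed into single integers.
\<close>

definition word_bound :: "nat \<Rightarrow> nat \<Rightarrow> int" where
  "word_bound k n = (int n + 2) ^ k"

text \<open>Row-major layout of an \<open>n \<times> n\<close> array.\<close>

definition row_major :: "nat \<Rightarrow> (nat \<Rightarrow> nat \<Rightarrow> int) \<Rightarrow> nat \<Rightarrow> int" where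
  "row_major n f p = (if p < n * n then f (p div n) (p mod n) else 0)"

text \<open>The dimension is in register 0, the two \<open>n \<times> n\<close> inputs are in arrays 0 and 1, all else is 0.\<close>

definition init_state :: "nat \<Rightarrow> (nat \<Rightarrow> nat \<Rightarrow> int) \<Rightarrow> (nat \<Rightarrow> nat \<Rightarrow> int) \<Rightarrow> ram_state" where
  "init_state n f g = \<lparr>reg = (\<lambda>_. 0)(0 := int n),
     arr = (\<lambda>_ _. 0)(0 := row_major n f, 1 := row_major n g)\<rparr>"


section \<open>The matrix multiplication exponent\<close>

text \<open>
  \<open>n \<times> n\<close> integer matrices with polynomially bounded entries (any fixed polynomial bound) can be
  multiplied in time \<open>O(n^\<tau>)\<close>. The product is delivered in array 2.
\<close>

definition mat_mult_time :: "real \<Rightarrow> bool" where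
  "mat_mult_time \<tau> \<longleftrightarrow> (\<forall>d. \<exists>c k C. \<forall>n\<ge>1. \<forall>A \<in> carrier_mat n n. \<forall>B \<in> carrier_mat n n.
     (\<forall>i<n. \<forall>j<n. \<bar>A $$ (i, j)\<bar> \<le> int n ^ d \<and> \<bar>B $$ (i, j)\<bar> \<le> int n ^ d) \<longrightarrow>
     (\<exists>t \<sigma>. exec (word_bound k n) c
              (init_state n (\<lambda>i j. A $$ (i, j)) (\<lambda>i j. B $$ (i, j))) t \<sigma> \<and>
            real t \<le> C * real n powr \<tau> \<and>
            (\<forall>i<n. \<forall>j<n. arr \<sigma> 2 (i * n + j) = (A * B) $$ (i, j))))"

definition omega :: real where
  "omega = Inf {\<tau>. mat_mult_time \<tau>}"


section \<open>Online matrix-vector multiplication with predictions\<close>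

definition bit_mats :: "nat \<Rightarrow> int mat set" where
  "bit_mats n = {A \<in> carrier_mat n n. \<forall>i<n. \<forall>j<n. A $$ (i, j) \<in> {0, 1}}"

definition bit_vecs :: "nat \<Rightarrow> int vec set" where
  "bit_vecs n = {v \<in> carrier_vec n. \<forall>i<n. v $ i \<in> {0, 1}}"

definition bool_mult_mat_vec :: "int mat \<Rightarrow> int vec \<Rightarrow> int vec" where
  "bool_mult_mat_vec A v =
     vec (dim_row A) (\<lambda>i. of_bool (\<exists>j<dim_vec v. A $$ (i, j) = 1 \<and> v $ j = 1))"

text \<open>
  An online vector is delivered in array 3, everything else in memory being left as it was, and
  the answer is expected in array 4.
\<close>

definition deliver :: "nat \<Rightarrow> int vec \<Rightarrow> ram_state \<Rightarrow> ram_state" where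
  "deliver n v \<sigma> =
     \<sigma>\<lparr>arr := (arr \<sigma>)(3 := (\<lambda>p. if p < n then v $ p else arr \<sigma> 3 p))\<rparr>"

definition answer :: "nat \<Rightarrow> ram_state \<Rightarrow> int vec" where
  "answer n \<sigma> = vec n (arr \<sigma> 4)"

text \<open>
  \<open>P\<close> preprocesses the matrix and the predictions (given as the rows of the second input). Then,
  for each arriving vector, \<open>Q\<close> is run on the memory left by the previous round; so the answer in
  round \<open>i\<close> depends on the vectors of rounds \<open>0, \<dots>, i\<close> only. Neither program is told \<open>\<Delta>\<close>.
\<close>

definition omv_with_predictions ::
  "(int mat \<Rightarrow> int vec \<Rightarrow> int vec) \<Rightarrow> real \<Rightarrow> com \<Rightarrow> com \<Rightarrow> nat \<Rightarrow> real \<Rightarrow> bool" where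
  "omv_with_predictions prd \<tau> P Q k C \<longleftrightarrow>
     (\<forall>n\<ge>1. \<forall>M \<in> bit_mats n. \<forall>v'. (\<forall>i<n. v' i \<in> bit_vecs n) \<longrightarrow>
       (\<exists>t0 \<sigma>0.
          exec (word_bound k n) P (init_state n (\<lambda>i j. M $$ (i, j)) (\<lambda>i j. v' i $ j)) t0 \<sigma>0 \<and>
          real t0 \<le> C * real n powr \<tau> \<and>
          (\<forall>\<Delta>::real. \<forall>v. 0 \<le> \<Delta> \<and> \<Delta> \<le> real n \<and>
             (\<forall>i<n. v i \<in> bit_vecs n \<and>
                real_of_int (EH (list_of_vec (v' i)) (list_of_vec (v i))) \<le> \<Delta>) \<longrightarrow>
             (\<exists>t \<sigma>. \<sigma> 0 = \<sigma>0 \<and>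
               (\<forall>i<n. exec (word_bound k n) Q (deliver n (v i) (\<sigma> i)) (t i) (\<sigma> (Suc i)) \<and>
                  real (t i) \<le> C * (real n * (1 + \<Delta>)) \<and>
                  answer n (\<sigma> (Suc i)) = prd M (v i))))))"

end

theory Submission
  imports Defs
begin

text \<open>
  Let \<open>x = v\<^sub>i - v'\<^sub>i\<close>, a vector with entries in \<open>{-1, 0, 1}\<close> that is constant on each of the blocks
  in the definition of \<open>EH\<close>; its number of jumps (starting from 0) is therefore at most twice
  \<open>EH v'\<^sub>i v\<^sub>i\<close>. A scan of \<open>v\<^sub>i\<close> from left to right maintains \<open>M u\<close> for the hybrid vector \<open>u\<close> that
  agrees with \<open>v\<^sub>i\<close> on the positions already read and continues with \<open>v'\<^sub>i\<close>, shifted by the last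
  entry of \<open>x\<close> seen. Initially this is \<open>M v'\<^sub>i\<close>, finally \<open>M v\<^sub>i\<close>, and reading position \<open>j\<close> adds
  \<open>(x\<^sub>j - x\<^sub>j\<^sub>-\<^sub>1) S\<^sub>j\<close>, where \<open>S\<^sub>j\<close> is the sum of the columns \<open>j, \<dots>, n - 1\<close> of \<open>M\<close>; so only the
  jumps cost more than \<open>O(1)\<close>, namely \<open>O(n)\<close> each.

  The vectors \<open>S\<^sub>j\<close> are tabulated in time \<open>O(n\<^sup>2)\<close>, and all \<open>M v'\<^sub>i\<close> are the columns of one matrix
  product. The quadratic part is absorbed because every multiplication program must write
  \<open>n\<^sup>2\<close> nonzero cells on the all-ones matrices, so that every admissible exponent is at least 2; and
  there are admissible exponents, since the naive algorithm is cubic.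
\<close>

section \<open>Program logic\<close>

notation Seq (infixr ";;" 60)

inductive_simps exec_Skip_iff: "exec W Skip \<sigma> t \<sigma>'"
  and exec_Op_iff: "exec W (Op r f a b) \<sigma> t \<sigma>'"
  and exec_Load_iff: "exec W (Load r A i) \<sigma> t \<sigma>'"
  and exec_Store_iff: "exec W (Store A i a) \<sigma> t \<sigma>'"
  and exec_Seq_iff: "exec W (c ;; d) \<sigma> t \<sigma>'"
  and exec_Cond_iff: "exec W (Cond a c d) \<sigma> t \<sigma>'"
  and exec_While_iff: "exec W (While a c) \<sigma> t \<sigma>'"

definition wp :: "int \<Rightarrow> com \<Rightarrow> (nat \<Rightarrow> ram_state \<Rightarrow> bool) \<Rightarrow> ram_state \<Rightarrow> bool" where
  "wp W c Q \<sigma> \<longleftrightarrow> (\<exists>t \<sigma>'. exec W c \<sigma> t \<sigma>' \<and> Q t \<sigma>')"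

lemma wp_Skip [simp]: "wp W Skip Q \<sigma> \<longleftrightarrow> Q 1 \<sigma>"
  by (simp add: wp_def exec_Skip_iff)

lemma wp_Op [simp]:
  "wp W (Op r f a b) Q \<sigma> \<longleftrightarrow>
     \<bar>apply_binop f (opval \<sigma> a) (opval \<sigma> b)\<bar> \<le> W \<and>
     Q 1 (\<sigma>\<lparr>reg := (reg \<sigma>)(r := apply_binop f (opval \<sigma> a) (opval \<sigma> b))\<rparr>)"
  by (auto simp: wp_def exec_Op_iff)

lemma wp_Load [simp]:
  "wp W (Load r A i) Q \<sigma> \<longleftrightarrow>
     0 \<le> opval \<sigma> i \<and> opval \<sigma> i \<le> W \<and> \<bar>arr \<sigma> A (nat (opval \<sigma> i))\<bar> \<le> W \<and>
     Q 1 (\<sigma>\<lparr>reg := (reg \<sigma>)(r := arr \<sigma> A (nat (opval \<sigma> i)))\<rparr>)"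
  by (auto simp: wp_def exec_Load_iff)

lemma wp_Store [simp]:
  "wp W (Store A i a) Q \<sigma> \<longleftrightarrow>
     0 \<le> opval \<sigma> i \<and> opval \<sigma> i \<le> W \<and> \<bar>opval \<sigma> a\<bar> \<le> W \<and>
     Q 1 (\<sigma>\<lparr>arr := (arr \<sigma>)(A := (arr \<sigma> A)(nat (opval \<sigma> i) := opval \<sigma> a))\<rparr>)"
  by (auto simp: wp_def exec_Store_iff)

lemma wp_Seq [simp]: "wp W (c ;; d) Q \<sigma> \<longleftrightarrow> wp W c (\<lambda>t. wp W d (\<lambda>u. Q (t + u))) \<sigma>"
  unfolding wp_def exec_Seq_iff by blast

lemma wp_Cond [simp]:
  "wp W (Cond a c d) Q \<sigma> \<longleftrightarrow> wp W (if opval \<sigma> a \<noteq> 0 then c else d) (\<lambda>t. Q (t + 1)) \<sigma>"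
  by (auto simp: wp_def exec_Cond_iff)

lemma wp_While:
  "wp W (While a c) Q \<sigma> \<longleftrightarrow>
     (if opval \<sigma> a \<noteq> 0 then wp W (c ;; While a c) (\<lambda>t. Q (t + 1)) \<sigma> else Q 1 \<sigma>)"
  unfolding wp_Seq by (subst wp_def, subst exec_While_iff) (simp add: wp_def, blast)

primrec reg_writes :: "com \<Rightarrow> nat set" where
  "reg_writes Skip = {}"
| "reg_writes (Op r f a b) = {r}"
| "reg_writes (Load r A i) = {r}"
| "reg_writes (Store A i a) = {}"
| "reg_writes (c ;; d) = reg_writes c \<union> reg_writes d"
| "reg_writes (Cond a c d) = reg_writes c \<union> reg_writes d"
| "reg_writes (While a c) = reg_writes c"

primrec arr_writes :: "com \<Rightarrow> nat set" where
  "arr_writes Skip = {}"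
| "arr_writes (Op r f a b) = {}"
| "arr_writes (Load r A i) = {}"
| "arr_writes (Store A i a) = {A}"
| "arr_writes (c ;; d) = arr_writes c \<union> arr_writes d"
| "arr_writes (Cond a c d) = arr_writes c \<union> arr_writes d"
| "arr_writes (While a c) = arr_writes c"

definition unwritten_eq :: "com \<Rightarrow> ram_state \<Rightarrow> ram_state \<Rightarrow> bool" where
  "unwritten_eq c \<sigma> \<tau> \<longleftrightarrow> (\<forall>r. r \<notin> reg_writes c \<longrightarrow> reg \<tau> r = reg \<sigma> r) \<and>
     (\<forall>A. A \<notin> arr_writes c \<longrightarrow> arr \<tau> A = arr \<sigma> A)"

lemma exec_unwritten_eq: "exec W c \<sigma> t \<sigma>' \<Longrightarrow> unwritten_eq c \<sigma> \<sigma>'"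
  by (induction rule: exec.induct) (auto simp: unwritten_eq_def)

lemma wp_conseq:
  assumes "wp W c Q \<sigma>" and "\<And>t \<sigma>'. Q t \<sigma>' \<Longrightarrow> unwritten_eq c \<sigma> \<sigma>' \<Longrightarrow> Q' t \<sigma>'"
  shows "wp W c Q' \<sigma>"
  using assms exec_unwritten_eq unfolding wp_def by blast

lemma wp_mono_word:
  assumes "wp W c Q \<sigma>" "W \<le> W'"
  shows "wp W' c Q \<sigma>"
proof -
  have "exec W' c \<sigma> t \<sigma>'" if "exec W c \<sigma> t \<sigma>'" for t \<sigma>'
    using that by (induction rule: exec.induct)
      (use \<open>W \<le> W'\<close> in \<open>auto intro: exec.intros simp del: One_nat_def\<close>)
  with assms(1) show ?thesis unfolding wp_def by blast
qed

definition For :: "nat \<Rightarrow> nat \<Rightarrow> com \<Rightarrow> com" where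
  "For r l c = Op r Add (Reg l) (Const 0) ;; While (Reg r) (Op r Sub (Reg r) (Const 1) ;; c)"

lemma reg_writes_For [simp]: "reg_writes (For r l c) = insert r (reg_writes c)"
  by (simp add: For_def)

lemma arr_writes_For [simp]: "arr_writes (For r l c) = arr_writes c"
  by (simp add: For_def)

lemma wp_For:
  assumes step: "\<And>i \<tau>. i < m \<Longrightarrow> J (Suc i) \<tau> \<Longrightarrow> unwritten_eq (For r l c) \<sigma> \<tau> \<Longrightarrow>
      wp W c (\<lambda>t \<tau>'. t \<le> K i \<and> J i \<tau>') (\<tau>\<lparr>reg := (reg \<tau>)(r := int i)\<rparr>)"
    and l: "reg \<sigma> l = int m" "int m \<le> W" and r: "r \<notin> reg_writes c"
    and init: "J m (\<sigma>\<lparr>reg := (reg \<sigma>)(r := int m)\<rparr>)"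
  shows "wp W (For r l c) (\<lambda>t \<sigma>'. t \<le> (\<Sum>i<m. K i + 2) + 2 \<and> J 0 \<sigma>') \<sigma>"
proof -
  let ?body = "Op r Sub (Reg r) (Const 1) ;; c"
  have loop: "wp W (While (Reg r) ?body) (\<lambda>t \<tau>'. t \<le> (\<Sum>i<k. K i + 2) + 1 \<and> J 0 \<tau>') \<tau>"
    if "k \<le> m" "J k \<tau>" "reg \<tau> r = int k" "unwritten_eq (For r l c) \<sigma> \<tau>" for k \<tau>
    using that
  proof (induction k arbitrary: \<tau>)
    case 0
    then show ?case by (simp add: wp_While)
  next
    case (Suc k)
    let ?\<tau> = "\<tau>\<lparr>reg := (reg \<tau>)(r := int k)\<rparr>"
    have "wp W c (\<lambda>t \<tau>'. t \<le> K k \<and> J k \<tau>') ?\<tau>"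
      using Suc.prems by (intro step) auto
    then have "wp W c (\<lambda>u. wp W (While (Reg r) ?body)
      (\<lambda>v \<tau>'. u + v + 2 \<le> (\<Sum>i<Suc k. K i + 2) + 1 \<and> J 0 \<tau>')) ?\<tau>"
    proof (rule wp_conseq, elim conjE)
      fix u \<tau>'
      assume "u \<le> K k" "J k \<tau>'" "unwritten_eq c ?\<tau> \<tau>'"
      moreover from this have "reg \<tau>' r = int k" "unwritten_eq (For r l c) \<sigma> \<tau>'"
        using r Suc.prems(4) by (auto simp: unwritten_eq_def)
      ultimately show "wp W (While (Reg r) ?body)
        (\<lambda>v \<tau>'. u + v + 2 \<le> (\<Sum>i<Suc k. K i + 2) + 1 \<and> J 0 \<tau>') \<tau>'"
        using Suc.prems(1) by (intro wp_conseq[OF Suc.IH]) auto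
    qed
    then show ?case
      using Suc.prems l(2) by (subst wp_While) (simp add: add.commute)
  qed
  have "wp W (While (Reg r) ?body) (\<lambda>t \<tau>'. t \<le> (\<Sum>i<m. K i + 2) + 1 \<and> J 0 \<tau>')
    (\<sigma>\<lparr>reg := (reg \<sigma>)(r := int m)\<rparr>)"
    using init by (intro loop) (auto simp: unwritten_eq_def)
  then show ?thesis
    using l by (simp add: For_def)
qed

lemma wp_For_const:
  assumes "\<And>i \<tau>. i < m \<Longrightarrow> J (Suc i) \<tau> \<Longrightarrow> unwritten_eq (For r l c) \<sigma> \<tau> \<Longrightarrow>
      wp W c (\<lambda>t \<tau>'. t \<le> K \<and> J i \<tau>') (\<tau>\<lparr>reg := (reg \<tau>)(r := int i)\<rparr>)"
    and "reg \<sigma> l = int m" "int m \<le> W" "r \<notin> reg_writes c"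
    and "J m (\<sigma>\<lparr>reg := (reg \<sigma>)(r := int m)\<rparr>)"
  shows "wp W (For r l c) (\<lambda>t \<sigma>'. t \<le> m * (K + 2) + 2 \<and> J 0 \<sigma>') \<sigma>"
  using wp_For[where K = "\<lambda>_. K", OF assms] by simp

definition fill :: "nat \<Rightarrow> nat \<Rightarrow> nat \<Rightarrow> nat \<Rightarrow> com \<Rightarrow> com" where
  "fill A v r l c = For r l (c ;; Store A (Reg r) (Reg v))"

lemma reg_writes_fill [simp]: "reg_writes (fill A v r l c) = insert r (reg_writes c)"
  by (simp add: fill_def)

lemma arr_writes_fill [simp]: "arr_writes (fill A v r l c) = insert A (arr_writes c)"
  by (simp add: fill_def)

lemma wp_fill:
  assumes body: "\<And>i \<tau>. i < m \<Longrightarrow> unwritten_eq (fill A v r l c) \<sigma> \<tau> \<Longrightarrow> reg \<tau> r = int i \<Longrightarrow>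
      arr \<tau> A = (\<lambda>q. if i < q \<and> q < m then h q else arr \<sigma> A q) \<Longrightarrow>
      wp W c (\<lambda>t \<tau>'. t \<le> K \<and> reg \<tau>' v = h i) \<tau>"
    and bound: "\<And>i. i < m \<Longrightarrow> \<bar>h i\<bar> \<le> W"
    and l: "reg \<sigma> l = int m" "int m \<le> W" and c: "r \<notin> reg_writes c" "arr_writes c = {}"
  shows "wp W (fill A v r l c) (\<lambda>t \<sigma>'. t \<le> m * (K + 3) + 2 \<and>
    arr \<sigma>' A = (\<lambda>q. if q < m then h q else arr \<sigma> A q)) \<sigma>"
proof -
  let ?J = "\<lambda>i \<tau>. arr \<tau> A = (\<lambda>q. if i \<le> q \<and> q < m then h q else arr \<sigma> A q)"
  let ?c = "c ;; Store A (Reg r) (Reg v)"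
  have "wp W (For r l ?c) (\<lambda>t \<sigma>'. t \<le> m * (Suc K + 2) + 2 \<and> ?J 0 \<sigma>') \<sigma>"
  proof (rule wp_For_const[where J = ?J], goal_cases step)
    case (step i \<tau>)
    have "wp W c (\<lambda>t \<tau>'. t \<le> K \<and> reg \<tau>' v = h i) (\<tau>\<lparr>reg := (reg \<tau>)(r := int i)\<rparr>)"
      using step by (intro body) (auto simp: unwritten_eq_def fill_def Suc_le_eq)
    then have "wp W c (\<lambda>t \<tau>'. wp W (Store A (Reg r) (Reg v)) (\<lambda>u \<rho>. t + u \<le> Suc K \<and> ?J i \<rho>) \<tau>')
      (\<tau>\<lparr>reg := (reg \<tau>)(r := int i)\<rparr>)"
    proof (rule wp_conseq, elim conjE)
      fix t \<tau>'
      assume "t \<le> K" "reg \<tau>' v = h i" "unwritten_eq c (\<tau>\<lparr>reg := (reg \<tau>)(r := int i)\<rparr>) \<tau>'"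
      moreover from this have "reg \<tau>' r = int i" "arr \<tau>' A = arr \<tau> A"
        using c by (auto simp: unwritten_eq_def)
      ultimately show "wp W (Store A (Reg r) (Reg v)) (\<lambda>u \<rho>. t + u \<le> Suc K \<and> ?J i \<rho>) \<tau>'"
        using step bound[of i] l by (auto simp: fun_eq_iff Suc_le_eq)
    qed
    then show ?case by (simp del: wp_Store)
  qed (use l c in auto)
  moreover have "Suc K + 2 = K + 3" by simp
  ultimately show ?thesis by (simp only: fill_def le0 simp_thms)
qed

section \<open>Locality of programs\<close>

primrec operand_names :: "operand \<Rightarrow> nat set" where
  "operand_names (Const c) = {}"
| "operand_names (Reg r) = {r}"

primrec names :: "com \<Rightarrow> nat set" where
  "names Skip = {}"
| "names (Op r f a b) = insert r (operand_names a \<union> operand_names b)"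
| "names (Load r A i) = insert r (insert A (operand_names i))"
| "names (Store A i a) = insert A (operand_names i \<union> operand_names a)"
| "names (c ;; d) = names c \<union> names d"
| "names (Cond a c d) = operand_names a \<union> names c \<union> names d"
| "names (While a c) = operand_names a \<union> names c"

lemma finite_names: "finite (names c)"
proof -
  have "finite (operand_names a)" for a by (cases a) auto
  then show ?thesis by (induction c) auto
qed

lemma writes_subset_names: "reg_writes c \<subseteq> names c" "arr_writes c \<subseteq> names c"
  by (induction c) auto

definition agree_on :: "nat set \<Rightarrow> ram_state \<Rightarrow> ram_state \<Rightarrow> bool" where
  "agree_on X \<sigma> \<tau> \<longleftrightarrow> (\<forall>x\<in>X. reg \<sigma> x = reg \<tau> x \<and> arr \<sigma> x = arr \<tau> x)"

lemma opval_agree_on: "agree_on X \<sigma> \<tau> \<Longrightarrow> operand_names a \<subseteq> X \<Longrightarrow> opval \<tau> a = opval \<sigma> a"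
  by (cases a) (auto simp: agree_on_def)

lemma agree_on_update:
  "agree_on X \<sigma> \<tau> \<Longrightarrow> agree_on X (\<sigma>\<lparr>reg := (reg \<sigma>)(r := x)\<rparr>) (\<tau>\<lparr>reg := (reg \<tau>)(r := x)\<rparr>)"
  "agree_on X \<sigma> \<tau> \<Longrightarrow> A \<in> X \<Longrightarrow>
    agree_on X (\<sigma>\<lparr>arr := (arr \<sigma>)(A := (arr \<sigma> A)(p := x))\<rparr>) (\<tau>\<lparr>arr := (arr \<tau>)(A := (arr \<tau> A)(p := x))\<rparr>)"
  by (auto simp: agree_on_def)

lemma exec_agree_on:
  assumes "exec W c \<sigma> t \<sigma>'" "names c \<subseteq> X" "agree_on X \<sigma> \<tau>"
  shows "\<exists>\<tau>'. exec W c \<tau> t \<tau>' \<and> agree_on X \<sigma>' \<tau>'"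
  using assms
proof (induction arbitrary: \<tau> rule: exec.induct)
  case (exec_Load \<sigma> i x A r)
  then have "arr \<sigma> A = arr \<tau> A" by (simp add: agree_on_def)
  with exec_Load show ?case
    using opval_agree_on[OF exec_Load.prems(2)] by (auto simp: exec_Load_iff agree_on_update)
next
  case (exec_Seq c \<sigma> t \<sigma>' d u \<sigma>'')
  then show ?case by (simp add: exec_Seq_iff) metis
next
  case (exec_WhileF \<sigma> a c)
  then show ?case
    using opval_agree_on[OF exec_WhileF.prems(2)]
    by (intro exI[of _ \<tau>]) (auto intro: exec.exec_WhileF simp del: One_nat_def)
next
  case (exec_WhileT \<sigma> a c t \<sigma>' u \<sigma>'')
  then obtain \<tau>' \<tau>'' where \<tau>: "exec W c \<tau> t \<tau>'" "exec W (While a c) \<tau>' u \<tau>''" "agree_on X \<sigma>'' \<tau>''"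
    by (metis Un_subset_iff names.simps(7))
  have "opval \<tau> a \<noteq> 0"
    using opval_agree_on[OF exec_WhileT.prems(2)] exec_WhileT.hyps(1) exec_WhileT.prems(1) by simp
  then show ?case using \<tau> exec.exec_WhileT by blast
qed (auto simp: exec_Skip_iff exec_Op_iff exec_Store_iff exec_Cond_iff opval_agree_on agree_on_update)

lemma wp_agree_on:
  assumes "wp W c Q \<sigma>" "names c \<subseteq> X" "agree_on X \<sigma> \<tau>"
  shows "wp W c (\<lambda>t \<tau>'. \<exists>\<sigma>'. Q t \<sigma>' \<and> agree_on X \<sigma>' \<tau>') \<tau>"
  using assms exec_agree_on unfolding wp_def by meson

section \<open>Indices, word sizes and sums\<close>

lemma index_less_square:
  assumes "i < n" "j < n"
  shows "i * n + j < n * (n::nat)"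
proof -
  have "i * n + j < Suc i * n" using \<open>j < n\<close> by simp
  also have "\<dots> \<le> n * n" using \<open>i < n\<close> by (intro mult_le_mono1) simp
  finally show ?thesis .
qed

lemma row_major_index [simp]: "i < n \<Longrightarrow> j < n \<Longrightarrow> row_major n f (i * n + j) = f i j"
  by (simp add: row_major_def index_less_square)

lemma row_major_cong:
  assumes "\<And>i j. i < n \<Longrightarrow> j < n \<Longrightarrow> f i j = g i j"
  shows "row_major n f = row_major n g"
proof
  fix q
  have "q div n < n" "q mod n < n" if "q < n * n"
    using that by (cases n; simp add: less_mult_imp_div_less)+
  then show "row_major n f q = row_major n g q"
    using assms by (simp add: row_major_def)
qed

lemma nat_index [simp]: "nat (int i * int m + int j) = i * m + j"
  by (metis nat_int of_nat_add of_nat_mult)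

lemma word_bound_mono: "k \<le> k' \<Longrightarrow> word_bound k n \<le> word_bound k' n"
  by (simp add: word_bound_def power_increasing)

lemma abs_sum_le:
  fixes f :: "'a \<Rightarrow> 'b::linordered_idom"
  assumes "\<And>x. x \<in> S \<Longrightarrow> \<bar>f x\<bar> \<le> K"
  shows "\<bar>sum f S\<bar> \<le> of_nat (card S) * K"
  by (rule order_trans[OF sum_abs sum_bounded_above]) (rule assms)

lemma abs_sum_mult_le:
  fixes f g :: "'a \<Rightarrow> 'b::linordered_idom"
  assumes "\<And>x. x \<in> S \<Longrightarrow> \<bar>f x\<bar> \<le> C" "\<And>x. x \<in> S \<Longrightarrow> \<bar>g x\<bar> \<le> D"
  shows "\<bar>\<Sum>x\<in>S. f x * g x\<bar> \<le> of_nat (card S) * (C * D)"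
proof (rule abs_sum_le)
  fix x assume x: "x \<in> S"
  have "0 \<le> C" using assms(1)[OF x] abs_ge_zero order_trans by blast
  then show "\<bar>f x * g x\<bar> \<le> C * D"
    unfolding abs_mult using assms x by (intro mult_mono) auto
qed

section \<open>Multiplication takes quadratic time\<close>

definition changed_cells :: "nat \<Rightarrow> ram_state \<Rightarrow> ram_state \<Rightarrow> nat set" where
  "changed_cells A \<sigma> \<tau> = {p. arr \<tau> A p \<noteq> arr \<sigma> A p}"

lemma changed_cells_refl [simp]: "changed_cells A \<sigma> \<sigma> = {}"
  by (simp add: changed_cells_def)

lemma changed_cells_trans: "changed_cells A \<rho> \<tau> \<subseteq> changed_cells A \<rho> \<sigma> \<union> changed_cells A \<sigma> \<tau>"
  by (auto simp: changed_cells_def)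

lemma card_subset_Un_le:
  assumes "C \<subseteq> A \<union> B" "finite A" "finite B"
  shows "finite C \<and> card C \<le> card A + card B"
  using assms card_mono[of "A \<union> B" C] card_Un_le[of A B] finite_subset[of C "A \<union> B"] by simp

lemma exec_changed_cells:
  "exec W c \<sigma> t \<sigma>' \<Longrightarrow> finite (changed_cells A \<sigma> \<sigma>') \<and> card (changed_cells A \<sigma> \<sigma>') \<le> t"
proof (induction rule: exec.induct)
  case (exec_Store \<sigma> i x a B)
  have "changed_cells A \<sigma> (\<sigma>\<lparr>arr := (arr \<sigma>)(B := (arr \<sigma> B)(nat (opval \<sigma> i) := x))\<rparr>)
      \<subseteq> {nat (opval \<sigma> i)}"
    by (auto simp: changed_cells_def)
  then show ?case using card_mono[of "{nat (opval \<sigma> i)}"] finite_subset by fastforce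
next
  case (exec_Seq c \<sigma> t \<sigma>' d u \<sigma>'')
  then show ?case
    using card_subset_Un_le[OF changed_cells_trans[of A \<sigma> \<sigma>'' \<sigma>']] by simp
next
  case (exec_WhileT \<sigma> a c t \<sigma>' u \<sigma>'')
  then show ?case
    using card_subset_Un_le[OF changed_cells_trans[of A \<sigma> \<sigma>'' \<sigma>']] by simp
qed (auto simp: changed_cells_def)

definition bounded_mats :: "nat \<Rightarrow> int \<Rightarrow> int mat set" where
  "bounded_mats n D = {A \<in> carrier_mat n n. \<forall>i<n. \<forall>j<n. \<bar>A $$ (i, j)\<bar> \<le> D}"

abbreviation load_mats :: "nat \<Rightarrow> int mat \<Rightarrow> int mat \<Rightarrow> ram_state" where
  "load_mats n A B \<equiv> init_state n (\<lambda>i j. A $$ (i, j)) (\<lambda>i j. B $$ (i, j))"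

definition mat_mult_program :: "nat \<Rightarrow> real \<Rightarrow> com \<Rightarrow> nat \<Rightarrow> real \<Rightarrow> bool" where
  "mat_mult_program d \<tau> c k C \<longleftrightarrow>
     (\<forall>n\<ge>1. \<forall>A \<in> bounded_mats n (int n ^ d). \<forall>B \<in> bounded_mats n (int n ^ d).
       wp (word_bound k n) c (\<lambda>t \<sigma>. real t \<le> C * real n powr \<tau> \<and>
         (\<forall>i<n. \<forall>j<n. arr \<sigma> 2 (i * n + j) = (A * B) $$ (i, j))) (load_mats n A B))"

lemma mat_mult_time_iff: "mat_mult_time \<tau> \<longleftrightarrow> (\<forall>d. \<exists>c k C. mat_mult_program d \<tau> c k C)"
proof -
  have bounded: "(\<forall>A \<in> bounded_mats n D. \<forall>B \<in> bounded_mats n D. P A B) \<longleftrightarrow>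
      (\<forall>A \<in> carrier_mat n n. \<forall>B \<in> carrier_mat n n.
        (\<forall>i<n. \<forall>j<n. \<bar>A $$ (i, j)\<bar> \<le> D \<and> \<bar>B $$ (i, j)\<bar> \<le> D) \<longrightarrow> P A B)" for n D P
    unfolding bounded_mats_def by blast
  show ?thesis
    unfolding mat_mult_time_def mat_mult_program_def wp_def bounded ..
qed

lemma mat_mult_program_time_ge:
  assumes prog: "mat_mult_program d \<tau> c k C" and n: "n \<ge> 1"
  shows "real n * real n \<le> C * real n powr \<tau>"
proof -
  define J :: "int mat" where "J = mat n n (\<lambda>_. 1)"
  have J: "J \<in> bounded_mats n (int n ^ d)"
    using n by (auto simp: J_def bounded_mats_def)
  obtain t \<sigma> where run: "exec (word_bound k n) c (load_mats n J J) t \<sigma>"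
    and time: "real t \<le> C * real n powr \<tau>"
    and result: "\<And>i j. i < n \<Longrightarrow> j < n \<Longrightarrow> arr \<sigma> 2 (i * n + j) = (J * J) $$ (i, j)"
    using prog[unfolded mat_mult_program_def, rule_format, OF n J J] unfolding wp_def by blast
  have "{..<n * n} \<subseteq> changed_cells 2 (load_mats n J J) \<sigma>"
  proof
    fix p assume "p \<in> {..<n * n}"
    then have "p div n < n" "p mod n < n"
      using n by (auto simp: less_mult_imp_div_less)
    then have "arr \<sigma> 2 p = int n"
      using result[of "p div n" "p mod n"] by (simp add: J_def scalar_prod_def)
    then show "p \<in> changed_cells 2 (load_mats n J J) \<sigma>"
      using n by (simp add: changed_cells_def init_state_def)
  qed
  then have "n * n \<le> t"
    using exec_changed_cells[OF run, of 2] card_mono[of "changed_cells 2 (load_mats n J J) \<sigma>" "{..<n * n}"]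
    by simp
  then show ?thesis
    using time by (metis of_nat_le_iff of_nat_mult order_trans)
qed

lemma powr_bounded_imp_nonpos:
  assumes bound: "\<And>n::nat. n \<ge> 1 \<Longrightarrow> real n powr a \<le> C"
  shows "a \<le> 0"
proof (rule ccontr)
  assume a: "\<not> a \<le> 0"
  define y where "y = (\<bar>C\<bar> + 1) powr (1 / a)"
  obtain n where n: "y < real n" using reals_Archimedean2 by blast
  have "y > 0" by (simp add: y_def)
  with n have "n \<ge> 1" by (cases n) auto
  have "\<bar>C\<bar> + 1 = y powr a" using a by (simp add: y_def powr_powr)
  also have "\<dots> < real n powr a" using n \<open>y > 0\<close> a by (intro powr_less_mono2) auto
  also have "\<dots> \<le> C" using bound \<open>n \<ge> 1\<close> .
  finally show False by simp
qed

lemma mat_mult_time_ge_2: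
  assumes "mat_mult_time \<tau>"
  shows "2 \<le> \<tau>"
proof -
  obtain c k C where prog: "mat_mult_program 0 \<tau> c k C"
    using assms unfolding mat_mult_time_iff by blast
  have "real n powr (2 - \<tau>) \<le> C" if n: "n \<ge> 1" for n
  proof -
    have "real n powr (2 - \<tau>) * real n powr \<tau> = real n * real n"
      using n by (simp flip: powr_add add: power2_eq_square)
    also have "\<dots> \<le> C * real n powr \<tau>" using prog n by (rule mat_mult_program_time_ge)
    finally show ?thesis using n by simp
  qed
  then have "2 - \<tau> \<le> 0" by (rule powr_bounded_imp_nonpos)
  then show ?thesis by simp
qed

section \<open>Programs with named registers\<close>

text \<open>
  All names used besides the interface are at least \<open>b\<close>, out of reach of the multiplication program
  that runs between the table construction and the queries. Row \<open>i\<close> of array \<open>predA\<close> is the \<open>i\<close>-th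
  prediction, row \<open>j\<close> of array \<open>tailA\<close> the vector \<open>S\<^sub>j\<close>.
\<close>

locale registers =
  fixes b :: nat
begin

abbreviation dimR :: nat where "dimR \<equiv> b"
abbreviation roundR :: nat where "roundR \<equiv> b + 1"
abbreviation sizeR :: nat where "sizeR \<equiv> b + 2"
abbreviation cellR :: nat where "cellR \<equiv> b + 3"
abbreviation rowR :: nat where "rowR \<equiv> b + 4"
abbreviation colR :: nat where "colR \<equiv> b + 5"
abbreviation idxR :: nat where "idxR \<equiv> b + 6"
abbreviation addrR :: nat where "addrR \<equiv> b + 7"
abbreviation accR :: nat where "accR \<equiv> b + 8"
abbreviation xR :: nat where "xR \<equiv> b + 9"
abbreviation yR :: nat where "yR \<equiv> b + 10"
abbreviation stepR :: nat where "stepR \<equiv> b + 11"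
abbreviation posR :: nat where "posR \<equiv> b + 12"
abbreviation deltaR :: nat where "deltaR \<equiv> b + 13"
abbreviation driftR :: nat where "driftR \<equiv> b + 14"

abbreviation predA :: nat where "predA \<equiv> b"
abbreviation tailA :: nat where "tailA \<equiv> b + 1"

definition load_entry :: "nat \<Rightarrow> nat \<Rightarrow> nat \<Rightarrow> nat \<Rightarrow> com" where
  "load_entry r A i j =
     Op addrR Mul (Reg i) (Reg dimR) ;;
     Op addrR Add (Reg addrR) (Reg j) ;;
     Load r A (Reg addrR)"

definition locate_cell :: com where
  "locate_cell = Op rowR Div (Reg cellR) (Reg dimR) ;; Op colR Mod (Reg cellR) (Reg dimR)"

definition fill_cells :: "nat \<Rightarrow> com \<Rightarrow> com" where
  "fill_cells A c = fill A accR cellR sizeR (locate_cell ;; c)"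

lemma writes_load_entry [simp]:
  "reg_writes (load_entry r A i j) = {addrR, r}" "arr_writes (load_entry r A i j) = {}"
  by (auto simp: load_entry_def)

lemma writes_fill_cells [simp]:
  "reg_writes (fill_cells A c) = {cellR, rowR, colR} \<union> reg_writes c"
  "arr_writes (fill_cells A c) = insert A (arr_writes c)"
  by (auto simp: fill_cells_def locate_cell_def)

end

locale word_ram = registers b for b +
  fixes n :: nat and W :: int
  assumes b_ge: "5 \<le> b" and n_ge: "1 \<le> n" and W_ge: "word_bound 2 n \<le> W"
begin

lemma word_bounds: "int n * int n + int n \<le> W" "2 * int n \<le> W" "int n * int n \<le> W" "int n \<le> W" "2 \<le> W"
proof -
  have "int n * int n + 4 * int n + 4 \<le> W"
    using W_ge by (simp add: word_bound_def power2_eq_square algebra_simps)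
  moreover have "0 \<le> int n * int n" by simp
  ultimately show "int n * int n + int n \<le> W" "2 * int n \<le> W" "int n * int n \<le> W" "int n \<le> W" "2 \<le> W"
    by linarith+
qed

lemma index_in_word:
  assumes "i < n" "j < n"
  shows "int i * int n + int j \<le> W" "int i * int n \<le> W"
proof -
  have "int (i * n + j) < int (n * n)"
    using index_less_square[OF assms] by (simp only: of_nat_less_iff)
  then show "int i * int n + int j \<le> W" "int i * int n \<le> W"
    using word_bounds by simp_all
qed

lemma wp_load_entry [simp]:
  assumes "reg \<sigma> dimR = int n" "reg \<sigma> ri = int i" "reg \<sigma> rj = int j" "i < n" "j < n" "rj \<noteq> addrR"
  shows "wp W (load_entry r A ri rj) Q \<sigma> \<longleftrightarrow> \<bar>arr \<sigma> A (i * n + j)\<bar> \<le> W \<and>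
    Q 3 (\<sigma>\<lparr>reg := (reg \<sigma>)(addrR := int (i * n + j), r := arr \<sigma> A (i * n + j))\<rparr>)"
  using assms index_in_word[of i j] by (simp add: load_entry_def numeral_3_eq_3)

lemma wp_locate_cell [simp]:
  assumes "reg \<sigma> dimR = int n" "reg \<sigma> cellR = int p" "p < n * n"
  shows "wp W locate_cell Q \<sigma> \<longleftrightarrow>
    Q 2 (\<sigma>\<lparr>reg := (reg \<sigma>)(rowR := int (p div n), colR := int (p mod n))\<rparr>)"
proof -
  have "int (p div n) \<le> W" "int (p mod n) \<le> W"
    using assms(3) n_ge word_bounds(4) less_mult_imp_div_less[of p n n] mod_less_divisor[of n p]
    by linarith+
  then show ?thesis
    using assms by (simp add: locate_cell_def numeral_2_eq_2 flip: zdiv_int zmod_int)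
qed

lemma wp_fill_cells:
  assumes body: "\<And>i j \<tau>. i < n \<Longrightarrow> j < n \<Longrightarrow> unwritten_eq (fill_cells A c) \<sigma> \<tau> \<Longrightarrow>
      reg \<tau> cellR = int (i * n + j) \<Longrightarrow> reg \<tau> rowR = int i \<Longrightarrow> reg \<tau> colR = int j \<Longrightarrow>
      arr \<tau> A = (\<lambda>q. if i * n + j < q then row_major n h q else arr \<sigma> A q) \<Longrightarrow>
      wp W c (\<lambda>t \<tau>'. t \<le> K \<and> reg \<tau>' accR = h i j) \<tau>"
    and bound: "\<And>i j. i < n \<Longrightarrow> j < n \<Longrightarrow> \<bar>h i j\<bar> \<le> W"
    and reg: "reg \<sigma> dimR = int n" "reg \<sigma> sizeR = int n * int n"
    and c: "dimR \<notin> reg_writes c" "cellR \<notin> reg_writes c" "arr_writes c = {}"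
    and outside: "\<And>q. n * n \<le> q \<Longrightarrow> arr \<sigma> A q = 0"
  shows "wp W (fill_cells A c) (\<lambda>t \<sigma>'. t \<le> n * n * (K + 5) + 2 \<and> arr \<sigma>' A = row_major n h) \<sigma>"
proof -
  have cell: "p div n < n" "p mod n < n" if "p < n * n" for p
    using that n_ge by (auto simp: less_mult_imp_div_less)
  have "wp W (fill A accR cellR sizeR (locate_cell ;; c)) (\<lambda>t \<sigma>'. t \<le> n * n * (K + 2 + 3) + 2 \<and>
    arr \<sigma>' A = (\<lambda>q. if q < n * n then row_major n h q else arr \<sigma> A q)) \<sigma>"
  proof (rule wp_fill, goal_cases step bounded)
    case (bounded p)
    then show ?case using bound cell by (simp add: row_major_def)
  next
    case (step p \<tau>)
    let ?\<tau> = "\<tau>\<lparr>reg := (reg \<tau>)(rowR := int (p div n), colR := int (p mod n))\<rparr>"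
    have "wp W c (\<lambda>t \<tau>'. t \<le> K \<and> reg \<tau>' accR = h (p div n) (p mod n)) ?\<tau>"
    proof (rule body)
      show "unwritten_eq (fill_cells A c) \<sigma> ?\<tau>"
        using step(2) by (auto simp: unwritten_eq_def fill_cells_def locate_cell_def)
      show "arr ?\<tau> A = (\<lambda>q. if p div n * n + p mod n < q then row_major n h q else arr \<sigma> A q)"
        using step(4) outside by (auto simp: row_major_def fun_eq_iff)
    qed (use step cell in auto)
    moreover have "reg \<tau> dimR = int n"
      using step(2) c reg by (auto simp: unwritten_eq_def locate_cell_def)
    ultimately show ?case
      using step by (simp add: row_major_def)
  qed (use reg c word_bounds in \<open>auto simp: locate_cell_def\<close>)
  moreover have "K + 2 + 3 = K + 5" by simp
  moreover have "(\<lambda>q. if q < n * n then row_major n h q else arr \<sigma> A q) = row_major n h"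
    using outside by (auto simp: row_major_def)
  ultimately show ?thesis by (simp only: fill_cells_def)
qed

end

section \<open>Naive multiplication\<close>

context registers
begin

definition inner_product :: com where
  "inner_product =
     Op accR Add (Const 0) (Const 0) ;;
     For idxR dimR
       (load_entry xR 0 rowR idxR ;;
        load_entry yR 1 idxR colR ;;
        Op xR Mul (Reg xR) (Reg yR) ;;
        Op accR Add (Reg accR) (Reg xR))"

definition naive_mult :: com where
  "naive_mult =
     Op dimR Add (Reg 0) (Const 0) ;;
     Op sizeR Mul (Reg 0) (Reg 0) ;;
     fill_cells 2 inner_product"

lemma writes_inner_product [simp]:
  "reg_writes inner_product = {accR, idxR, addrR, xR, yR}" "arr_writes inner_product = {}"
  by (auto simp: inner_product_def)

end

context word_ram
begin

lemma wp_inner_product: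
  assumes reg: "reg \<sigma> dimR = int n" "reg \<sigma> rowR = int i" "reg \<sigma> colR = int j"
    and arr: "arr \<sigma> 0 = row_major n f" "arr \<sigma> 1 = row_major n g"
    and ij: "i < n" "j < n"
    and f: "\<And>k. k < n \<Longrightarrow> \<bar>f i k\<bar> \<le> D" and g: "\<And>k. k < n \<Longrightarrow> \<bar>g k j\<bar> \<le> D"
    and D: "1 \<le> D" "int n * (D * D) \<le> W"
  shows "wp W inner_product (\<lambda>t \<sigma>'. t \<le> n * 10 + 3 \<and> reg \<sigma>' accR = (\<Sum>k<n. f i k * g k j)) \<sigma>"
proof -
  define \<rho> where "\<rho> = \<sigma>\<lparr>reg := (reg \<sigma>)(accR := 0)\<rparr>"
  have "D \<le> D * D" using D(1) by simp
  moreover have "D * D \<le> int n * (D * D)" using n_ge mult_right_mono[of 1 "int n" "D * D"] by simp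
  ultimately have D_le: "D \<le> W" "D * D \<le> W" using D(2) by linarith+
  have product: "\<bar>f i k * g k j\<bar> \<le> D * D" if "k < n" for k
    unfolding abs_mult using f g that D by (intro mult_mono) auto
  have partial: "\<bar>\<Sum>k=m..<n. f i k * g k j\<bar> \<le> W" for m
  proof -
    have "\<bar>\<Sum>k=m..<n. f i k * g k j\<bar> \<le> int (card {m..<n}) * (D * D)"
      using f g by (intro abs_sum_mult_le) auto
    also have "\<dots> \<le> int n * (D * D)" using D by (intro mult_right_mono) auto
    finally show ?thesis using D by simp
  qed
  let ?J = "\<lambda>m \<tau>. reg \<tau> accR = (\<Sum>k=m..<n. f i k * g k j)"
  let ?body = "load_entry xR 0 rowR idxR ;; load_entry yR 1 idxR colR ;;
    Op xR Mul (Reg xR) (Reg yR) ;; Op accR Add (Reg accR) (Reg xR)"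
  have "wp W (For idxR dimR ?body) (\<lambda>t \<tau>. t \<le> n * (8 + 2) + 2 \<and> ?J 0 \<tau>) \<rho>"
  proof (rule wp_For_const[where J = ?J], goal_cases step)
    case (step k \<tau>)
    then have "reg \<tau> dimR = int n" "reg \<tau> rowR = int i" "reg \<tau> colR = int j"
      "arr \<tau> 0 = row_major n f" "arr \<tau> 1 = row_major n g"
      using reg arr by (simp_all add: unwritten_eq_def \<rho>_def)
    moreover have "(\<Sum>k=Suc k..<n. f i k * g k j) + f i k * g k j = (\<Sum>k=k..<n. f i k * g k j)"
      using step(1) by (simp add: sum.atLeast_Suc_lessThan)
    moreover have "\<bar>f i k\<bar> \<le> W" "\<bar>g k j\<bar> \<le> W" "\<bar>f i k * g k j\<bar> \<le> W"
      using f g product step(1) D_le by (meson order_trans)+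
    ultimately show ?case
      using step ij partial[of k] by simp
  qed (use reg word_bounds in \<open>auto simp: \<rho>_def\<close>)
  then show ?thesis
    using word_bounds by (auto simp: inner_product_def \<rho>_def atLeast0LessThan elim: wp_conseq)
qed

lemma wp_naive_mult:
  assumes A: "A \<in> bounded_mats n D" and B: "B \<in> bounded_mats n D"
    and D: "1 \<le> D" "int n * (D * D) \<le> W"
  shows "wp W naive_mult (\<lambda>t \<sigma>. t \<le> n * n * (n * 10 + 8) + 4 \<and>
    arr \<sigma> 2 = row_major n (\<lambda>i j. (A * B) $$ (i, j))) (load_mats n A B)"
proof -
  let ?A = "\<lambda>i j. A $$ (i, j)" and ?B = "\<lambda>i j. B $$ (i, j)"
  define \<sigma> where "\<sigma> = (load_mats n A B)\<lparr>reg := (\<lambda>_. 0)(0 := int n, dimR := int n, sizeR := int n * int n)\<rparr>"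
  have entry: "(A * B) $$ (i, j) = (\<Sum>k<n. ?A i k * ?B k j)" if "i < n" "j < n" for i j
    using A B that by (auto simp: bounded_mats_def scalar_prod_def atLeast0LessThan)
  have bounds: "\<bar>?A i j\<bar> \<le> D" "\<bar>?B i j\<bar> \<le> D" if "i < n" "j < n" for i j
    using A B that by (auto simp: bounded_mats_def)
  have "wp W (fill_cells 2 inner_product) (\<lambda>t \<sigma>'. t \<le> n * n * ((n * 10 + 3) + 5) + 2 \<and>
      arr \<sigma>' 2 = row_major n (\<lambda>i j. (A * B) $$ (i, j))) \<sigma>"
  proof (rule wp_fill_cells, goal_cases step bounded)
    case (bounded i j)
    have "\<bar>\<Sum>k<n. ?A i k * ?B k j\<bar> \<le> int (card {..<n}) * (D * D)"
      using bounded bounds by (intro abs_sum_mult_le) auto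
    then show ?case using entry[OF bounded] D by simp
  next
    case (step i j \<tau>)
    have "wp W inner_product (\<lambda>t \<tau>'. t \<le> n * 10 + 3 \<and> reg \<tau>' accR = (\<Sum>k<n. ?A i k * ?B k j)) \<tau>"
      by (rule wp_inner_product[OF _ step(5,6)])
        (use step bounds D in \<open>auto simp: unwritten_eq_def \<sigma>_def init_state_def\<close>)
    then show ?case using entry[OF step(1,2)] by simp
  qed (auto simp: \<sigma>_def init_state_def)
  then show ?thesis
    using word_bounds b_ge
    by (auto simp: naive_mult_def \<sigma>_def init_state_def add.commute elim: wp_conseq)
qed

end

lemma naive_mult_program: "mat_mult_program d 3 (registers.naive_mult 5) (2 * d + 2) 22"
  unfolding mat_mult_program_def
proof (intro allI impI ballI)
  fix n and A B :: "int mat"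
  assume n: "1 \<le> n" and AB: "A \<in> bounded_mats n (int n ^ d)" "B \<in> bounded_mats n (int n ^ d)"
  let ?W = "word_bound (2 * d + 2) n"
  interpret word_ram 5 n ?W
    by unfold_locales (use n in \<open>auto intro: word_bound_mono\<close>)
  have "int n * (int n ^ d * int n ^ d) = int n ^ (2 * d + 1)"
    by (simp add: power_add mult_2)
  also have "\<dots> \<le> word_bound (2 * d + 1) n"
    unfolding word_bound_def by (intro power_mono) auto
  also have "\<dots> \<le> ?W"
    by (intro word_bound_mono) simp
  finally have "wp ?W naive_mult (\<lambda>t \<sigma>. t \<le> n * n * (n * 10 + 8) + 4 \<and>
      arr \<sigma> 2 = row_major n (\<lambda>i j. (A * B) $$ (i, j))) (load_mats n A B)"
    using AB n by (intro wp_naive_mult) auto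
  then show "wp ?W naive_mult (\<lambda>t \<sigma>. real t \<le> 22 * real n powr 3 \<and>
      (\<forall>i<n. \<forall>j<n. arr \<sigma> 2 (i * n + j) = (A * B) $$ (i, j))) (load_mats n A B)"
  proof (rule wp_conseq, elim conjE, intro conjI)
    fix t assume t: "t \<le> n * n * (n * 10 + 8) + 4"
    have "n * n \<le> n * n * n" "1 \<le> n * n * n" using n by auto
    moreover have "n * n * (n * 10 + 8) + 4 = 10 * (n * n * n) + 8 * (n * n) + 4"
      by (simp add: algebra_simps)
    ultimately have "t \<le> 22 * (n * n * n)" using t by linarith
    then have "real t \<le> real (22 * (n * n * n))" by (rule of_nat_mono)
    also have "\<dots> = 22 * real n powr 3" using n by (simp add: powr_numeral power3_eq_cube)
    finally show "real t \<le> 22 * real n powr 3" .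
  qed simp
qed

section \<open>Extended Hamming distance and jumps\<close>

definition jumps :: "'a \<Rightarrow> 'a list \<Rightarrow> nat" where
  "jumps x xs = (\<Sum>j<length xs. of_bool (xs ! j \<noteq> (x # xs) ! j))"

lemma jumps_Nil [simp]: "jumps x [] = 0"
  by (simp add: jumps_def)

lemma jumps_Cons [simp]: "jumps x (y # ys) = of_bool (y \<noteq> x) + jumps y ys"
  unfolding jumps_def length_Cons sum.lessThan_Suc_shift by simp

lemma jumps_le_change_start: "jumps x zs \<le> of_bool (x \<noteq> y) + jumps y zs"
  by (cases zs) auto

lemma jumps_replicate_append_le: "jumps x (replicate k y @ zs) \<le> of_bool (y \<noteq> x) + jumps y zs"
proof (induction k arbitrary: x)
  case 0
  then show ?case using jumps_le_change_start[of x zs y] by auto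
next
  case (Suc k)
  then show ?case using Suc.IH[of y] by simp
qed

lemma block_len_le: "block_len s t \<le> length s" "block_len s t \<le> length t"
  and nth_block: "i < block_len s t \<Longrightarrow> s ! i = s ! 0" "i < block_len s t \<Longrightarrow> t ! i = t ! 0"
proof -
  have "block_len s t \<le> length s \<and> block_len s t \<le> length t \<and>
    (\<forall>i<block_len s t. s ! i = s ! 0 \<and> t ! i = t ! 0)"
    unfolding block_len_def by (rule GreatestI_nat[where k = 0 and b = "length s"]) auto
  then show "block_len s t \<le> length s" "block_len s t \<le> length t"
    "i < block_len s t \<Longrightarrow> s ! i = s ! 0" "i < block_len s t \<Longrightarrow> t ! i = t ! 0"
    by blast+
qed

lemma take_block_diff:
  "take (block_len s t) (map2 (-) t s) = replicate (block_len s t) (t ! 0 - s ! 0)"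
proof (rule nth_equalityI)
  show len: "length (take (block_len s t) (map2 (-) t s)) =
      length (replicate (block_len s t) (t ! 0 - s ! 0))"
    using block_len_le[of s t] by simp
  show "take (block_len s t) (map2 (-) t s) ! i = replicate (block_len s t) (t ! 0 - s ! 0) ! i"
    if "i < length (take (block_len s t) (map2 (-) t s))" for i
    using that nth_block[of i s t] by simp
qed

lemma jumps_le_twice_EH:
  assumes "length s = length t" "set s \<subseteq> {0, 1}" "set t \<subseteq> {0, 1}"
  shows "int (jumps 0 (map2 (-) t s)) \<le> 2 * EH s t"
  using assms
proof (induction s t rule: EH.induct)
  case (1 s t)
  show ?case
  proof (cases "s = []")
    case True
    then show ?thesis by (subst EH.simps) simp
  next
    case False
    then have ne: "s \<noteq> []" "t \<noteq> []" using "1.prems"(1) by auto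
    define l where "l = block_len s t"
    define d where "d = t ! 0 - s ! 0"
    let ?rest = "map2 (-) (drop l t) (drop l s)"
    have "take l (map2 (-) t s) = replicate l d"
      unfolding l_def d_def by (rule take_block_diff)
    then have "map2 (-) t s = replicate l d @ ?rest"
      using append_take_drop_id[of l "map2 (-) t s"] by (simp add: drop_map drop_zip)
    then have "jumps 0 (map2 (-) t s) \<le> of_bool (d \<noteq> 0) + jumps d ?rest"
      by (simp only: jumps_replicate_append_le)
    also have "jumps d ?rest \<le> of_bool (d \<noteq> 0) + jumps 0 ?rest"
      by (rule jumps_le_change_start)
    finally have "int (jumps 0 (map2 (-) t s)) \<le> 2 * of_bool (d \<noteq> 0) + int (jumps 0 ?rest)"
      by (cases "d = 0") auto
    also have "int (jumps 0 ?rest) \<le> 2 * EH (drop l s) (drop l t)"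
      unfolding l_def
    proof (rule "1.IH")
      show "set (drop (block_len s t) s) \<subseteq> {0, 1}" "set (drop (block_len s t) t) \<subseteq> {0, 1}"
        using "1.prems"(2,3) set_drop_subset by fast+
    qed (use ne "1.prems"(1) in auto)
    also have "of_bool (d \<noteq> 0) = (s ! 0 + t ! 0) mod 2"
    proof -
      have "s ! 0 \<in> {0, 1}" "t ! 0 \<in> {0, 1}" using ne "1.prems"(2,3) nth_mem by blast+
      then show ?thesis by (auto simp: d_def)
    qed
    finally show ?thesis
      using ne by (simp add: EH.simps[of s t] l_def)
  qed
qed

section \<open>Interpolating between a prediction and the actual vector\<close>

definition drift :: "int vec \<Rightarrow> int vec \<Rightarrow> nat \<Rightarrow> int" where
  "drift u w j = (0 # list_of_vec (w - u)) ! j"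

lemma drift_0 [simp]: "drift u w 0 = 0"
  by (simp add: drift_def)

lemma drift_Suc [simp]: "j < dim_vec u \<Longrightarrow> drift u w (Suc j) = w $ j - u $ j"
  by (simp add: drift_def list_of_vec_index)

lemma jumps_diff_eq_sum:
  "dim_vec u = n \<Longrightarrow>
    jumps 0 (list_of_vec (w - u)) = (\<Sum>j<n. of_bool (drift u w (Suc j) \<noteq> drift u w j))"
  by (simp add: jumps_def drift_def)

lemma jumps_diff_le_twice_EH:
  assumes "u \<in> bit_vecs n" "w \<in> bit_vecs n"
  shows "int (jumps 0 (list_of_vec (w - u))) \<le> 2 * EH (list_of_vec u) (list_of_vec w)"
proof -
  have dim: "dim_vec u = n" "dim_vec w = n"
    using assms by (auto simp: bit_vecs_def)
  then have diff: "list_of_vec (w - u) = map2 (-) (list_of_vec w) (list_of_vec u)"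
    by (intro nth_equalityI) (auto simp: list_of_vec_index)
  have "set (list_of_vec u) \<subseteq> {0, 1}" "set (list_of_vec w) \<subseteq> {0, 1}"
    using assms dim by (auto simp: bit_vecs_def in_set_conv_nth list_of_vec_index)
  then show ?thesis
    unfolding diff using dim by (intro jumps_le_twice_EH) auto
qed

lemma drift_bound:
  assumes "u \<in> bit_vecs n" "w \<in> bit_vecs n" "m \<le> n"
  shows "\<bar>drift u w m\<bar> \<le> 1"
proof (cases m)
  case (Suc i)
  then have "dim_vec u = n" "u $ i \<in> {0, 1}" "w $ i \<in> {0, 1}"
    using assms by (auto simp: bit_vecs_def)
  with Suc \<open>m \<le> n\<close> show ?thesis by auto
qed simp

definition hybrid :: "int vec \<Rightarrow> int vec \<Rightarrow> nat \<Rightarrow> int vec" where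
  "hybrid u w m = vec (dim_vec w) (\<lambda>j. if j < m then w $ j else u $ j + drift u w m)"

lemma hybrid_0 [simp]: "dim_vec u = dim_vec w \<Longrightarrow> hybrid u w 0 = u"
  by (auto simp: hybrid_def)

lemma hybrid_dim_vec [simp]: "hybrid u w (dim_vec w) = w"
  by (auto simp: hybrid_def)

lemma hybrid_bound:
  assumes "u \<in> bit_vecs n" "w \<in> bit_vecs n" "m \<le> n" "j < n"
  shows "\<bar>hybrid u w m $ j\<bar> \<le> 2"
proof -
  have "dim_vec w = n" "u $ j \<in> {0, 1}" "w $ j \<in> {0, 1}"
    using assms by (auto simp: bit_vecs_def)
  then show ?thesis
    using drift_bound[OF assms(1-3)] \<open>j < n\<close> by (auto simp: hybrid_def)
qed

lemma hybrid_Suc_eq: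
  assumes "dim_vec u = dim_vec w" "m < dim_vec w" "drift u w (Suc m) = drift u w m"
  shows "hybrid u w (Suc m) = hybrid u w m"
  using assms by (auto simp: hybrid_def less_Suc_eq)

definition tail_sum :: "int mat \<Rightarrow> nat \<Rightarrow> nat \<Rightarrow> int" where
  "tail_sum M j a = (\<Sum>k=j..<dim_col M. M $$ (a, k))"

lemma mult_mat_vec_index_sum:
  "a < dim_row M \<Longrightarrow> dim_vec v = dim_col M \<Longrightarrow> (M *\<^sub>v v) $ a = (\<Sum>j<dim_col M. M $$ (a, j) * v $ j)"
  by (simp add: scalar_prod_def atLeast0LessThan)

lemma mult_hybrid_Suc:
  assumes M: "a < dim_row M" "dim_vec w = dim_col M" "dim_vec u = dim_col M" and m: "m < dim_col M"
  shows "(M *\<^sub>v hybrid u w (Suc m)) $ a =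
    (M *\<^sub>v hybrid u w m) $ a + tail_sum M m a * (drift u w (Suc m) - drift u w m)"
proof -
  let ?n = "dim_col M" and ?d = "drift u w (Suc m) - drift u w m"
  have dim: "dim_vec (hybrid u w i) = ?n" for i
    using M by (simp add: hybrid_def)
  have step: "hybrid u w (Suc m) $ j = hybrid u w m $ j + (if m \<le> j then ?d else 0)" if "j < ?n" for j
    using M m that by (auto simp: hybrid_def not_less less_Suc_eq)
  have "(M *\<^sub>v hybrid u w (Suc m)) $ a = (\<Sum>j<?n. M $$ (a, j) * hybrid u w (Suc m) $ j)"
    using M dim by (intro mult_mat_vec_index_sum) auto
  also have "\<dots> = (\<Sum>j<?n. M $$ (a, j) * hybrid u w m $ j + (if m \<le> j then M $$ (a, j) * ?d else 0))"
    by (intro sum.cong) (auto simp: step distrib_left)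
  also have "\<dots> = (M *\<^sub>v hybrid u w m) $ a + (\<Sum>j<?n. if m \<le> j then M $$ (a, j) * ?d else 0)"
    using M dim by (simp add: sum.distrib mult_mat_vec_index_sum del: index_mult_mat_vec)
  also have "(\<Sum>j<?n. if m \<le> j then M $$ (a, j) * ?d else 0) = (\<Sum>j=m..<?n. M $$ (a, j) * ?d)"
    by (intro sum.mono_neutral_cong_right) auto
  finally show ?thesis
    by (simp add: tail_sum_def sum_distrib_right)
qed

section \<open>Preprocessing\<close>

context registers
begin

definition copy_predictions :: com where
  "copy_predictions = fill_cells predA (load_entry accR 1 rowR colR)"

definition tabulate_tails :: com where
  "tabulate_tails = fill_cells tailA
     (Op addrR Add (Reg cellR) (Reg dimR) ;;
      Load accR tailA (Reg addrR) ;;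
      load_entry xR 0 colR rowR ;;
      Op accR Add (Reg accR) (Reg xR))"

definition transpose_predictions :: com where
  "transpose_predictions = fill_cells 1 (load_entry accR predA colR rowR)"

definition build_tables :: com where
  "build_tables =
     Op dimR Add (Reg 0) (Const 0) ;;
     Op sizeR Mul (Reg 0) (Reg 0) ;;
     copy_predictions ;;
     tabulate_tails ;;
     transpose_predictions"

lemma writes_table_programs [simp]:
  "reg_writes copy_predictions = {cellR, rowR, colR, addrR, accR}"
  "arr_writes copy_predictions = {predA}"
  "reg_writes tabulate_tails = {cellR, rowR, colR, addrR, accR, xR}"
  "arr_writes tabulate_tails = {tailA}"
  "reg_writes transpose_predictions = {cellR, rowR, colR, addrR, accR}"
  "arr_writes transpose_predictions = {1}"
  by (auto simp: copy_predictions_def tabulate_tails_def transpose_predictions_def)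

lemma writes_build_tables:
  "reg_writes build_tables = {dimR, sizeR, cellR, rowR, colR, addrR, accR, xR}"
  "arr_writes build_tables = {predA, tailA, 1}"
  by (auto simp: build_tables_def)

end

locale omv = word_ram b n W for b n W +
  fixes M :: "int mat" and pred :: "nat \<Rightarrow> int vec"
  assumes M_bits: "M \<in> bit_mats n" and pred_bits: "i < n \<Longrightarrow> pred i \<in> bit_vecs n"
begin

lemma dim_M [simp]: "dim_row M = n" "dim_col M = n"
  using M_bits by (auto simp: bit_mats_def)

lemma M_entry: "i < n \<Longrightarrow> j < n \<Longrightarrow> M $$ (i, j) \<in> {0, 1}"
  using M_bits by (auto simp: bit_mats_def)

lemma dim_pred [simp]: "i < n \<Longrightarrow> dim_vec (pred i) = n"
  using pred_bits by (auto simp: bit_vecs_def)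

lemma pred_entry: "i < n \<Longrightarrow> j < n \<Longrightarrow> pred i $ j \<in> {0, 1}"
  using pred_bits by (auto simp: bit_vecs_def)

lemma bit_in_word: "x \<in> {0, 1} \<Longrightarrow> \<bar>x\<bar> \<le> W"
  using word_bounds by auto

lemma tail_sum_bound: "a < n \<Longrightarrow> \<bar>tail_sum M j a\<bar> \<le> int n"
proof -
  assume a: "a < n"
  have "\<bar>M $$ (a, k)\<bar> \<le> 1" if "k < n" for k
    using M_entry[OF a that] by auto
  then have "\<bar>tail_sum M j a\<bar> \<le> int (card {j..<n}) * 1"
    unfolding tail_sum_def dim_M by (intro abs_sum_le) auto
  then show ?thesis by simp
qed

lemma mult_mat_vec_bound:
  assumes "a < n" "dim_vec x = n" "\<And>j. j < n \<Longrightarrow> \<bar>x $ j\<bar> \<le> K"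
  shows "\<bar>(M *\<^sub>v x) $ a\<bar> \<le> int n * K"
proof -
  have "\<bar>M $$ (a, j)\<bar> \<le> 1" if "j < n" for j
    using M_entry[OF assms(1) that] by auto
  then have "\<bar>\<Sum>j<n. M $$ (a, j) * x $ j\<bar> \<le> int (card {..<n}) * (1 * K)"
    using assms(3) by (intro abs_sum_mult_le) auto
  then show ?thesis
    using mult_mat_vec_index_sum[of a M x] assms by simp
qed

definition tables :: "ram_state \<Rightarrow> bool" where
  "tables \<sigma> \<longleftrightarrow> reg \<sigma> dimR = int n \<and> arr \<sigma> predA = row_major n (\<lambda>i j. pred i $ j) \<and>
     arr \<sigma> tailA = row_major n (tail_sum M)"

lemma wp_copy_predictions:
  assumes "reg \<sigma> dimR = int n" "reg \<sigma> sizeR = int n * int n"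
    and "arr \<sigma> 1 = row_major n (\<lambda>i j. pred i $ j)" "arr \<sigma> predA = (\<lambda>_. 0)"
  shows "wp W copy_predictions (\<lambda>t \<sigma>'. t \<le> n * n * 8 + 2 \<and>
    arr \<sigma>' predA = row_major n (\<lambda>i j. pred i $ j)) \<sigma>"
proof -
  have "wp W copy_predictions (\<lambda>t \<sigma>'. t \<le> n * n * (3 + 5) + 2 \<and>
    arr \<sigma>' predA = row_major n (\<lambda>i j. pred i $ j)) \<sigma>"
    unfolding copy_predictions_def
  proof (rule wp_fill_cells, goal_cases step)
    case (step i j \<tau>)
    then have "reg \<tau> dimR = int n" "arr \<tau> 1 = row_major n (\<lambda>i j. pred i $ j)"
      using assms b_ge by (auto simp: unwritten_eq_def)
    then show ?case
      using step bit_in_word[OF pred_entry] by simp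
  qed (use assms bit_in_word[OF pred_entry] in auto)
  then show ?thesis by simp
qed

lemma wp_tabulate_tails:
  assumes "reg \<sigma> dimR = int n" "reg \<sigma> sizeR = int n * int n"
    and "arr \<sigma> 0 = row_major n (\<lambda>i j. M $$ (i, j))" "arr \<sigma> tailA = (\<lambda>_. 0)"
  shows "wp W tabulate_tails (\<lambda>t \<sigma>'. t \<le> n * n * 11 + 2 \<and> arr \<sigma>' tailA = row_major n (tail_sum M)) \<sigma>"
proof -
  have tail: "\<bar>tail_sum M j a\<bar> \<le> W" if "a < n" for j a
    using tail_sum_bound[OF that, of j] word_bounds by linarith
  have "wp W tabulate_tails (\<lambda>t \<sigma>'. t \<le> n * n * (6 + 5) + 2 \<and>
    arr \<sigma>' tailA = row_major n (tail_sum M)) \<sigma>"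
    unfolding tabulate_tails_def
  proof (rule wp_fill_cells, goal_cases step)
    case (step j a \<tau>)
    have \<tau>: "reg \<tau> dimR = int n" "arr \<tau> 0 = row_major n (\<lambda>i j. M $$ (i, j))"
      using step(3) assms b_ge by (auto simp: unwritten_eq_def)
    have "row_major n (tail_sum M) (Suc j * n + a) = tail_sum M (Suc j) a"
    proof (cases "Suc j < n")
      case True
      then show ?thesis using step(2) by (rule row_major_index)
    next
      case False
      then have "Suc j = n" using step(1) by simp
      then show ?thesis by (simp add: row_major_def tail_sum_def)
    qed
    then have next_row: "arr \<tau> tailA (j * n + a + n) = tail_sum M (Suc j) a"
      using step(2,7) n_ge by (simp add: add_ac)
    have "tail_sum M (Suc j) a + M $$ (a, j) = tail_sum M j a"
      using step(1) by (simp add: tail_sum_def sum.atLeast_Suc_lessThan)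
    moreover have "int (j * n + a + n) \<le> W"
      using index_less_square[OF step(1,2)] word_bounds(1) by (simp flip: of_nat_mult)
    moreover have "nat (int j * int n + int a + int n) = j * n + a + n"
      by (simp add: nat_add_distrib)
    ultimately show ?case
      using step \<tau> next_row tail[OF step(2)] bit_in_word[OF M_entry[OF step(2,1)]] by simp
  qed (use assms tail in auto)
  then show ?thesis by simp
qed

lemma wp_transpose_predictions:
  assumes "reg \<sigma> dimR = int n" "reg \<sigma> sizeR = int n * int n"
    and "arr \<sigma> predA = row_major n (\<lambda>i j. pred i $ j)" "\<And>q. n * n \<le> q \<Longrightarrow> arr \<sigma> 1 q = 0"
  shows "wp W transpose_predictions (\<lambda>t \<sigma>'. t \<le> n * n * 8 + 2 \<and>
    arr \<sigma>' 1 = row_major n (\<lambda>i j. pred j $ i)) \<sigma>"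
proof -
  have "wp W transpose_predictions (\<lambda>t \<sigma>'. t \<le> n * n * (3 + 5) + 2 \<and>
    arr \<sigma>' 1 = row_major n (\<lambda>i j. pred j $ i)) \<sigma>"
    unfolding transpose_predictions_def
  proof (rule wp_fill_cells, goal_cases step)
    case (step i j \<tau>)
    then have "reg \<tau> dimR = int n" "arr \<tau> predA = row_major n (\<lambda>i j. pred i $ j)"
      using assms b_ge by (auto simp: unwritten_eq_def)
    then show ?case
      using step bit_in_word[OF pred_entry] by simp
  qed (use assms bit_in_word[OF pred_entry] in auto)
  then show ?thesis by simp
qed

abbreviation input_state :: ram_state where
  "input_state \<equiv> init_state n (\<lambda>i j. M $$ (i, j)) (\<lambda>i j. pred i $ j)"

lemma wp_build_tables:
  "wp W build_tables (\<lambda>t \<sigma>. t \<le> n * n * 27 + 8 \<and> tables \<sigma> \<and>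
     arr \<sigma> 1 = row_major n (\<lambda>i j. pred j $ i)) input_state"
proof -
  let ?\<rho> = "input_state\<lparr>reg := (reg input_state)(dimR := int n, sizeR := int n * int n)\<rparr>"
  let ?Q = "\<lambda>t \<sigma>. t \<le> n * n * 27 + 6 \<and> tables \<sigma> \<and> arr \<sigma> 1 = row_major n (\<lambda>i j. pred j $ i)"
  have copy: "wp W copy_predictions (\<lambda>t \<sigma>. t \<le> n * n * 8 + 2 \<and>
      arr \<sigma> predA = row_major n (\<lambda>i j. pred i $ j)) ?\<rho>"
    using b_ge by (intro wp_copy_predictions) (auto simp: init_state_def)
  have "wp W (copy_predictions ;; tabulate_tails ;; transpose_predictions) ?Q ?\<rho>"
    unfolding wp_Seq
  proof (rule wp_conseq[OF copy])
    fix t \<sigma>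
    assume copied: "t \<le> n * n * 8 + 2 \<and> arr \<sigma> predA = row_major n (\<lambda>i j. pred i $ j)"
      "unwritten_eq copy_predictions ?\<rho> \<sigma>"
    have tails: "wp W tabulate_tails (\<lambda>t \<sigma>'. t \<le> n * n * 11 + 2 \<and>
        arr \<sigma>' tailA = row_major n (tail_sum M)) \<sigma>"
      using copied b_ge by (intro wp_tabulate_tails) (auto simp: unwritten_eq_def init_state_def)
    show "wp W tabulate_tails (\<lambda>u. wp W transpose_predictions (\<lambda>v. ?Q (t + (u + v)))) \<sigma>"
    proof (rule wp_conseq[OF tails])
      fix u \<sigma>'
      assume tabulated: "u \<le> n * n * 11 + 2 \<and> arr \<sigma>' tailA = row_major n (tail_sum M)"
        "unwritten_eq tabulate_tails \<sigma> \<sigma>'"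
      show "wp W transpose_predictions (\<lambda>v. ?Q (t + (u + v))) \<sigma>'"
        by (rule wp_conseq[OF wp_transpose_predictions])
          (use copied tabulated b_ge
            in \<open>auto simp: unwritten_eq_def tables_def init_state_def row_major_def\<close>)
    qed
  qed
  then show ?thesis
    using word_bounds b_ge
    by (simp add: build_tables_def init_state_def add.commute)
qed

definition ready :: "nat \<Rightarrow> ram_state \<Rightarrow> bool" where
  "ready i \<sigma> \<longleftrightarrow> tables \<sigma> \<and> reg \<sigma> roundR = int i \<and>
     (\<forall>a<n. \<forall>k<n. arr \<sigma> 2 (a * n + k) = (M *\<^sub>v pred k) $ a)"

lemma ready_unwritten:
  assumes "ready i \<sigma>" "unwritten_eq c \<sigma> \<tau>"
    and "{dimR, roundR} \<inter> reg_writes c = {}" "{2, predA, tailA} \<inter> arr_writes c = {}"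
  shows "ready i \<tau>"
  using assms by (auto simp: ready_def tables_def unwritten_eq_def)

abbreviation pred_mat :: "int mat" where
  "pred_mat \<equiv> mat_of_cols n (map pred [0..<n])"

lemma wp_multiply_predictions:
  assumes prog: "mat_mult_program 0 \<tau> c k C" and c: "names c \<subseteq> {..<b}" and k: "word_bound k n \<le> W"
    and \<sigma>: "tables \<sigma>" "reg \<sigma> roundR = 0" "agree_on {..<b} (load_mats n M pred_mat) \<sigma>"
  shows "wp W c (\<lambda>t \<sigma>'. real t \<le> C * real n powr \<tau> \<and> ready 0 \<sigma>') \<sigma>"
proof -
  have "\<bar>M $$ (i, j)\<bar> \<le> 1" "\<bar>pred_mat $$ (i, j)\<bar> \<le> 1" if "i < n" "j < n" for i j
    using M_entry[OF that] pred_entry[OF that(2,1)] that by (auto simp: mat_of_cols_index)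
  moreover have "M \<in> carrier_mat n n" "pred_mat \<in> carrier_mat n n"
    using M_bits by (auto simp: bit_mats_def mat_of_cols_def)
  ultimately have bounded: "M \<in> bounded_mats n (int n ^ 0)" "pred_mat \<in> bounded_mats n (int n ^ 0)"
    by (simp_all add: bounded_mats_def)
  note run = wp_mono_word[OF prog[unfolded mat_mult_program_def, rule_format, OF n_ge bounded] k]
  show ?thesis
  proof (rule wp_conseq[OF wp_agree_on[OF run c \<sigma>(3)]], elim exE conjE, intro conjI)
    fix t \<sigma>\<^sub>0 \<sigma>'
    assume agree: "agree_on {..<b} \<sigma>\<^sub>0 \<sigma>'" and unwritten: "unwritten_eq c \<sigma> \<sigma>'"
      and product: "\<forall>i<n. \<forall>j<n. arr \<sigma>\<^sub>0 2 (i * n + j) = (M * pred_mat) $$ (i, j)"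
    have "arr \<sigma>\<^sub>0 2 = arr \<sigma>' 2"
      using agree b_ge by (simp add: agree_on_def)
    then have "arr \<sigma>' 2 (a * n + i) = (M *\<^sub>v pred i) $ a" if "a < n" "i < n" for a i
      using product that pred_bits[of i] by (simp add: bit_vecs_def)
    moreover have "reg \<sigma>' x = reg \<sigma> x" "arr \<sigma>' x = arr \<sigma> x" if "b \<le> x" for x
    proof -
      have "x \<notin> names c" using c that by auto
      then show "reg \<sigma>' x = reg \<sigma> x" "arr \<sigma>' x = arr \<sigma> x"
        using unwritten writes_subset_names[of c] by (auto simp: unwritten_eq_def)
    qed
    ultimately show "ready 0 \<sigma>'"
      using \<sigma>(1,2) by (simp add: ready_def tables_def)
  qed
qed

lemma wp_preprocess:
  assumes "mat_mult_program 0 \<tau> c k C" and "names c \<subseteq> {..<b}" and "word_bound k n \<le> W"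
  shows "wp W (build_tables ;; c) (\<lambda>t \<sigma>. real t \<le> real (n * n * 27 + 8) + C * real n powr \<tau> \<and>
    ready 0 \<sigma>) input_state"
  unfolding wp_Seq
proof (rule wp_conseq[OF wp_build_tables], elim conjE)
  fix t \<sigma>
  assume t: "t \<le> n * n * 27 + 8" and \<sigma>: "tables \<sigma>" "arr \<sigma> 1 = row_major n (\<lambda>i j. pred j $ i)"
    and unwritten: "unwritten_eq build_tables input_state \<sigma>"
  have "row_major n (\<lambda>i j. pred_mat $$ (i, j)) = arr \<sigma> 1"
    unfolding \<sigma>(2) by (rule row_major_cong) (simp add: mat_of_cols_index)
  then have "agree_on {..<b} (load_mats n M pred_mat) \<sigma>"
    using unwritten by (auto simp: agree_on_def unwritten_eq_def init_state_def writes_build_tables)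
  moreover have "reg \<sigma> roundR = 0"
    using unwritten b_ge by (simp add: unwritten_eq_def writes_build_tables init_state_def)
  ultimately have "wp W c (\<lambda>u \<sigma>'. real u \<le> C * real n powr \<tau> \<and> ready 0 \<sigma>') \<sigma>"
    using assms \<sigma>(1) by (intro wp_multiply_predictions)
  moreover have "real t \<le> real (n * n * 27 + 8)"
    using t by (rule of_nat_mono)
  ultimately show "wp W c (\<lambda>u \<sigma>'. real (t + u) \<le> real (n * n * 27 + 8) + C * real n powr \<tau> \<and> ready 0 \<sigma>') \<sigma>"
    by (elim wp_conseq) (auto simp only: of_nat_add intro: add_mono)
qed

lemma wp_preprocess_powr:
  assumes "mat_mult_program 0 \<tau> c k C" "names c \<subseteq> {..<b}" "word_bound k n \<le> W"
    and \<tau>: "2 \<le> \<tau>" "\<tau> \<le> \<tau>'"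
  shows "wp W (build_tables ;; c) (\<lambda>t \<sigma>. real t \<le> (\<bar>C\<bar> + 64) * real n powr \<tau>' \<and> ready 0 \<sigma>) input_state"
proof (rule wp_conseq[OF wp_preprocess[OF assms(1-3)]], elim conjE, intro conjI)
  fix t assume t: "real t \<le> real (n * n * 27 + 8) + C * real n powr \<tau>"
  have "real n * real n = real n powr 2" using n_ge by (simp add: power2_eq_square)
  also have "\<dots> \<le> real n powr \<tau>'" using n_ge \<tau> by (intro powr_mono) auto
  finally have square: "real n * real n \<le> real n powr \<tau>'" .
  have "1 \<le> real n powr \<tau>'" using n_ge \<tau> by (intro ge_one_powr_ge_zero) auto
  moreover have "C * real n powr \<tau> \<le> \<bar>C\<bar> * real n powr \<tau>'"
    using n_ge \<tau> by (intro mult_mono powr_mono) auto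
  ultimately show "real t \<le> (\<bar>C\<bar> + 64) * real n powr \<tau>'"
    using t square by (simp add: distrib_right)
qed

end

section \<open>Answering a query\<close>

context registers
begin

definition update_answer :: "com \<Rightarrow> com" where
  "update_answer c = fill 4 accR idxR dimR c"

definition load_product :: com where
  "load_product = update_answer (load_entry accR 2 idxR roundR)"

definition add_tail :: com where
  "add_tail = update_answer
     (load_entry xR tailA posR idxR ;;
      Op xR Mul (Reg xR) (Reg deltaR) ;;
      Load accR 4 (Reg idxR) ;;
      Op accR Add (Reg accR) (Reg xR))"

definition scan_position :: com where
  "scan_position =
     Op posR Sub (Reg dimR) (Reg stepR) ;;
     Op posR Sub (Reg posR) (Const 1) ;;
     load_entry accR predA roundR posR ;;
     Load xR 3 (Reg posR) ;;
     Op accR Sub (Reg xR) (Reg accR) ;;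
     Op deltaR Sub (Reg accR) (Reg driftR) ;;
     Op driftR Add (Reg accR) (Const 0) ;;
     Cond (Reg deltaR) add_tail Skip"

definition scan :: com where
  "scan = Op driftR Add (Const 0) (Const 0) ;; For stepR dimR scan_position"

definition query :: com where
  "query =
     load_product ;;
     scan ;;
     Op roundR Add (Reg roundR) (Const 1)"

definition booleanise :: com where
  "booleanise = update_answer (Load accR 4 (Reg idxR) ;; Op accR Less (Const 0) (Reg accR))"

lemma writes_query_programs [simp]:
  "reg_writes load_product = {idxR, addrR, accR}" "arr_writes load_product = {4}"
  "reg_writes add_tail = {idxR, addrR, accR, xR}" "arr_writes add_tail = {4}"
  "reg_writes scan_position = {posR, addrR, accR, xR, deltaR, driftR, idxR}"
  "arr_writes scan_position = {4}"
  "reg_writes scan = {stepR, posR, addrR, accR, xR, deltaR, driftR, idxR}" "arr_writes scan = {4}"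
  "reg_writes booleanise = {idxR, accR}" "arr_writes booleanise = {4}"
  by (auto simp: load_product_def add_tail_def scan_position_def scan_def booleanise_def
      update_answer_def)

end

lemma answer_cong: "arr \<tau> 4 = arr \<sigma> 4 \<Longrightarrow> answer n \<tau> = answer n \<sigma>"
  by (simp add: answer_def)

context word_ram
begin

lemma wp_update_answer:
  assumes body: "\<And>a \<tau>. a < n \<Longrightarrow> unwritten_eq (update_answer c) \<sigma> \<tau> \<Longrightarrow> reg \<tau> idxR = int a \<Longrightarrow>
      arr \<tau> 4 a = answer n \<sigma> $ a \<Longrightarrow> wp W c (\<lambda>t \<tau>'. t \<le> K \<and> reg \<tau>' accR = h a) \<tau>"
    and bound: "\<And>a. a < n \<Longrightarrow> \<bar>h a\<bar> \<le> W"
    and "reg \<sigma> dimR = int n" and c: "idxR \<notin> reg_writes c" "arr_writes c = {}"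
  shows "wp W (update_answer c) (\<lambda>t \<sigma>'. t \<le> n * (K + 3) + 2 \<and> answer n \<sigma>' = vec n h) \<sigma>"
proof -
  have "wp W (update_answer c) (\<lambda>t \<sigma>'. t \<le> n * (K + 3) + 2 \<and>
    arr \<sigma>' 4 = (\<lambda>a. if a < n then h a else arr \<sigma> 4 a)) \<sigma>"
    unfolding update_answer_def
    by (rule wp_fill) (use assms word_bounds in \<open>auto simp: update_answer_def answer_def\<close>)
  then show ?thesis
    by (rule wp_conseq) (auto simp: answer_def)
qed

end

context omv
begin

lemma vec_mult_mat_vec: "vec n (\<lambda>a. (M *\<^sub>v x) $ a) = M *\<^sub>v x"
  by (intro eq_vecI) auto

lemma mult_bit_vec_bound:
  assumes "w \<in> bit_vecs n" "a < n"
  shows "\<bar>(M *\<^sub>v w) $ a\<bar> \<le> W"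
proof -
  have "dim_vec w = n" "\<And>j. j < n \<Longrightarrow> \<bar>w $ j\<bar> \<le> 1"
    using assms(1) by (auto simp: bit_vecs_def)
  then have "\<bar>(M *\<^sub>v w) $ a\<bar> \<le> int n * 1"
    using \<open>a < n\<close> by (intro mult_mat_vec_bound)
  then show ?thesis using word_bounds by linarith
qed

lemma wp_load_product:
  assumes \<sigma>: "ready i \<sigma>" and i: "i < n"
  shows "wp W load_product (\<lambda>t \<sigma>'. t \<le> n * 6 + 2 \<and> answer n \<sigma>' = M *\<^sub>v pred i) \<sigma>"
proof -
  note bound = mult_bit_vec_bound[OF pred_bits[OF i]]
  have "wp W load_product (\<lambda>t \<sigma>'. t \<le> n * (3 + 3) + 2 \<and> answer n \<sigma>' = vec n (\<lambda>a. (M *\<^sub>v pred i) $ a)) \<sigma>"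
    unfolding load_product_def
  proof (rule wp_update_answer, goal_cases step)
    case (step a \<tau>)
    then have "ready i \<tau>"
      using b_ge by (intro ready_unwritten[OF \<sigma>]) (auto simp: update_answer_def)
    then have "reg \<tau> dimR = int n" "reg \<tau> roundR = int i" "arr \<tau> 2 (a * n + i) = (M *\<^sub>v pred i) $ a"
      using step(1) i by (auto simp: ready_def tables_def)
    then show ?case
      using step i bound by (simp del: index_mult_mat_vec)
  qed (use \<sigma> bound in \<open>auto simp: ready_def tables_def\<close>)
  then show ?thesis
    by (simp add: vec_mult_mat_vec)
qed

lemma mult_hybrid_bound:
  assumes "i < n" "w \<in> bit_vecs n" "m \<le> n" "a < n"
  shows "\<bar>(M *\<^sub>v hybrid (pred i) w m) $ a\<bar> \<le> W"
proof -
  have "dim_vec (hybrid (pred i) w m) = n"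
    using assms(2) by (auto simp: hybrid_def bit_vecs_def)
  then have "\<bar>(M *\<^sub>v hybrid (pred i) w m) $ a\<bar> \<le> int n * 2"
    using assms hybrid_bound[OF pred_bits] by (intro mult_mat_vec_bound) auto
  then show ?thesis using word_bounds by linarith
qed

lemma tail_drift_bound:
  assumes "i < n" "w \<in> bit_vecs n" "m < n" "a < n"
  shows "\<bar>tail_sum M m a * (drift (pred i) w (Suc m) - drift (pred i) w m)\<bar> \<le> W"
proof -
  let ?d = "drift (pred i) w (Suc m) - drift (pred i) w m"
  have "\<bar>drift (pred i) w k\<bar> \<le> 1" if "k \<le> n" for k
    using drift_bound[OF pred_bits] assms that by blast
  from this[of m] this[of "Suc m"] have "\<bar>?d\<bar> \<le> 2"
    using \<open>m < n\<close> by linarith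
  then have "\<bar>tail_sum M m a * ?d\<bar> \<le> int n * 2"
    unfolding abs_mult using tail_sum_bound[OF \<open>a < n\<close>, of m] by (intro mult_mono) auto
  then show ?thesis
    using word_bounds by linarith
qed

lemma wp_add_tail:
  assumes \<sigma>: "ready i \<sigma>" and i: "i < n" and w: "w \<in> bit_vecs n" and m: "m < n"
    and reg: "reg \<sigma> posR = int m" "reg \<sigma> deltaR = drift (pred i) w (Suc m) - drift (pred i) w m"
    and answer: "answer n \<sigma> = M *\<^sub>v hybrid (pred i) w m"
  shows "wp W add_tail (\<lambda>t \<sigma>'. t \<le> n * 9 + 2 \<and> answer n \<sigma>' = M *\<^sub>v hybrid (pred i) w (Suc m)) \<sigma>"
proof -
  let ?x = "\<lambda>m. M *\<^sub>v hybrid (pred i) w m" and ?d = "drift (pred i) w (Suc m) - drift (pred i) w m"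
  have dim: "dim_vec w = n"
    using w by (auto simp: bit_vecs_def)
  have bound: "\<bar>?x k $ a\<bar> \<le> W" if "a < n" "k \<le> n" for a k
    using mult_hybrid_bound i w that by blast
  have update: "?x m $ a + tail_sum M m a * ?d = ?x (Suc m) $ a" if "a < n" for a
    using mult_hybrid_Suc[of a M w "pred i" m] that i m dim by simp
  have "wp W add_tail (\<lambda>t \<sigma>'. t \<le> n * (6 + 3) + 2 \<and> answer n \<sigma>' = vec n (\<lambda>a. ?x (Suc m) $ a)) \<sigma>"
    unfolding add_tail_def
  proof (rule wp_update_answer, goal_cases step)
    case (step a \<tau>)
    then have "ready i \<tau>"
      using b_ge by (intro ready_unwritten[OF \<sigma>]) (auto simp: update_answer_def)
    then have \<tau>: "reg \<tau> dimR = int n" "arr \<tau> tailA = row_major n (tail_sum M)"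
      by (auto simp: ready_def tables_def)
    have \<tau>': "reg \<tau> posR = int m" "reg \<tau> deltaR = ?d"
      using step(2) reg by (auto simp: unwritten_eq_def update_answer_def)
    have "int a \<le> W" "\<bar>tail_sum M m a\<bar> \<le> W"
      using step(1) tail_sum_bound[OF step(1), of m] word_bounds by linarith+
    then show ?case
      using step m answer \<tau> \<tau>' bound[of a] update[of a] tail_drift_bound[OF i w m step(1)]
      by (simp del: index_mult_mat_vec)
  qed (use \<sigma> m bound in \<open>auto simp: ready_def tables_def\<close>)
  then show ?thesis
    by (simp add: vec_mult_mat_vec)
qed

lemma wp_add_tail_if_jump:
  assumes \<sigma>: "ready i \<sigma>" and i: "i < n" and w: "w \<in> bit_vecs n" and m: "m < n"
    and reg: "reg \<sigma> posR = int m" "reg \<sigma> deltaR = drift (pred i) w (Suc m) - drift (pred i) w m"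
    and answer: "answer n \<sigma> = M *\<^sub>v hybrid (pred i) w m"
  shows "wp W (Cond (Reg deltaR) add_tail Skip) (\<lambda>t \<sigma>'.
      t \<le> 2 + of_bool (drift (pred i) w (Suc m) \<noteq> drift (pred i) w m) * (n * 9 + 2) \<and>
      answer n \<sigma>' = M *\<^sub>v hybrid (pred i) w (Suc m)) \<sigma>"
proof (cases "drift (pred i) w (Suc m) = drift (pred i) w m")
  case True
  then have "hybrid (pred i) w (Suc m) = hybrid (pred i) w m"
    using w i m by (intro hybrid_Suc_eq) (auto simp: bit_vecs_def)
  then show ?thesis
    using True reg answer by simp
next
  case False
  then show ?thesis
    using reg by (auto intro: wp_conseq[OF wp_add_tail[OF assms]])
qed

lemma wp_scan_position:
  assumes \<sigma>: "ready i \<sigma>" and i: "i < n" and w: "w \<in> bit_vecs n" "\<And>j. j < n \<Longrightarrow> arr \<sigma> 3 j = w $ j"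
    and m: "m < n" and reg: "reg \<sigma> stepR = int (n - Suc m)" "reg \<sigma> driftR = drift (pred i) w m"
    and answer: "answer n \<sigma> = M *\<^sub>v hybrid (pred i) w m"
  shows "wp W scan_position (\<lambda>t \<sigma>'.
      t \<le> 11 + of_bool (drift (pred i) w (Suc m) \<noteq> drift (pred i) w m) * (n * 9 + 2) \<and>
      reg \<sigma>' driftR = drift (pred i) w (Suc m) \<and>
      answer n \<sigma>' = M *\<^sub>v hybrid (pred i) w (Suc m)) \<sigma>"
proof -
  let ?new = "drift (pred i) w (Suc m)" and ?old = "drift (pred i) w m"
  have tail: "wp W (Cond (Reg deltaR) add_tail Skip) (\<lambda>t \<sigma>'.
      t + 9 \<le> 11 + of_bool (?new \<noteq> ?old) * (n * 9 + 2) \<and> reg \<sigma>' driftR = ?new \<and>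
      answer n \<sigma>' = M *\<^sub>v hybrid (pred i) w (Suc m)) \<tau>"
    if "ready i \<tau>" "reg \<tau> posR = int m" "reg \<tau> deltaR = ?new - ?old" "reg \<tau> driftR = ?new"
      "arr \<tau> 4 = arr \<sigma> 4" for \<tau>
    using that i w(1) m answer answer_cong[OF that(5)]
    by (intro wp_conseq[OF wp_add_tail_if_jump]) (auto simp: unwritten_eq_def)
  have \<sigma>': "reg \<sigma> dimR = int n" "reg \<sigma> roundR = int i" "arr \<sigma> predA = row_major n (\<lambda>i j. pred i $ j)"
    using \<sigma> by (auto simp: ready_def tables_def)
  have bits: "pred i $ m \<in> {0, 1}" "w $ m \<in> {0, 1}"
    using pred_entry[OF i m] w(1) m by (auto simp: bit_vecs_def)
  have drifts: "?new = w $ m - pred i $ m" "\<bar>?new\<bar> \<le> 1" "\<bar>?old\<bar> \<le> 1"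
    using i m w(1) drift_bound[OF pred_bits[OF i] w(1)] by (simp, simp_all del: drift_Suc)
  have pos: "int n - int (n - Suc m) = int m + 1" "int m + 1 \<le> W"
    using m word_bounds by auto
  have "\<bar>pred i $ m\<bar> \<le> W" "\<bar>w $ m\<bar> \<le> W" "\<bar>?new\<bar> \<le> W" "\<bar>?new - ?old\<bar> \<le> W"
    using bits bit_in_word drifts(2,3) word_bounds by (blast, blast, linarith, linarith)
  then show ?thesis
    using \<sigma> \<sigma>' i m w(2)[OF m] reg pos
    by (auto simp: scan_position_def drifts(1) ready_def tables_def simp del: wp_Cond
        intro!: wp_conseq[OF tail])
qed

lemma wp_scan:
  assumes \<sigma>: "ready i \<sigma>" and i: "i < n" and w: "w \<in> bit_vecs n" "\<And>j. j < n \<Longrightarrow> arr \<sigma> 3 j = w $ j"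
    and answer: "answer n \<sigma> = M *\<^sub>v pred i"
  shows "wp W scan (\<lambda>t \<sigma>'. t \<le> n * 13 + jumps 0 (list_of_vec (w - pred i)) * (n * 9 + 2) + 3 \<and>
    answer n \<sigma>' = M *\<^sub>v w) \<sigma>"
proof -
  let ?jump = "\<lambda>m. of_bool (drift (pred i) w (Suc m) \<noteq> drift (pred i) w m) :: nat"
  let ?inv = "\<lambda>k \<tau>. reg \<tau> driftR = drift (pred i) w (n - k) \<and>
    answer n \<tau> = M *\<^sub>v hybrid (pred i) w (n - k)"
  define \<rho> where "\<rho> = \<sigma>\<lparr>reg := (reg \<sigma>)(driftR := 0)\<rparr>"
  have \<rho>: "ready i \<rho>" "arr \<rho> 3 = arr \<sigma> 3" "reg \<rho> driftR = 0" "answer n \<rho> = M *\<^sub>v pred i"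
    using \<sigma> answer by (auto simp: \<rho>_def ready_def tables_def answer_def)
  have dim: "dim_vec w = n"
    using w(1) by (auto simp: bit_vecs_def)
  have "wp W (For stepR dimR scan_position) (\<lambda>t \<tau>'.
    t \<le> (\<Sum>k<n. 11 + ?jump (n - Suc k) * (n * 9 + 2) + 2) + 2 \<and> ?inv 0 \<tau>') \<rho>"
  proof (rule wp_For[where J = ?inv], goal_cases step)
    case (step k \<tau>)
    have "n - k = Suc (n - Suc k)" "n - Suc (n - Suc k) = k"
      using step(1) by auto
    moreover have "ready i \<tau>" "arr \<tau> 3 = arr \<sigma> 3"
      using ready_unwritten[OF \<rho>(1) step(3)] step(3) \<rho>(2) b_ge by (auto simp: unwritten_eq_def)
    ultimately show ?case
      using step i w
      by (intro wp_conseq[OF wp_scan_position[where i = i and w = w and m = "n - Suc k"]])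
        (auto simp: ready_def tables_def answer_def simp del: drift_Suc)
  qed (use \<rho> i dim word_bounds in \<open>auto simp: ready_def tables_def answer_def\<close>)
  moreover have "(\<Sum>k<n. 11 + ?jump (n - Suc k) * (n * 9 + 2) + 2) =
      n * 13 + jumps 0 (list_of_vec (w - pred i)) * (n * 9 + 2)"
    using i sum.nat_diff_reindex[of ?jump n]
    by (simp add: jumps_diff_eq_sum[of _ n] sum.distrib flip: sum_distrib_right)
  ultimately show ?thesis
    using dim hybrid_dim_vec[of "pred i" w] word_bounds
    by (auto simp: scan_def \<rho>_def elim: wp_conseq)
qed

lemma wp_query:
  assumes \<sigma>: "ready i \<sigma>" and i: "i < n" and w: "w \<in> bit_vecs n" "\<And>j. j < n \<Longrightarrow> arr \<sigma> 3 j = w $ j"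
  shows "wp W query (\<lambda>t \<sigma>'. t \<le> 25 * (n * (1 + jumps 0 (list_of_vec (w - pred i)))) \<and>
    ready (Suc i) \<sigma>' \<and> answer n \<sigma>' = M *\<^sub>v w) \<sigma>"
  unfolding query_def wp_Seq
proof (rule wp_conseq[OF wp_load_product[OF \<sigma> i]], elim conjE)
  let ?J = "jumps 0 (list_of_vec (w - pred i))"
  fix t \<tau>
  assume t: "t \<le> n * 6 + 2" and answer: "answer n \<tau> = M *\<^sub>v pred i"
    and unwritten: "unwritten_eq load_product \<sigma> \<tau>"
  have \<tau>: "ready i \<tau>" "arr \<tau> 3 = arr \<sigma> 3"
    using ready_unwritten[OF \<sigma> unwritten] unwritten b_ge by (auto simp: unwritten_eq_def)
  have scan: "wp W scan (\<lambda>u \<sigma>'. u \<le> n * 13 + ?J * (n * 9 + 2) + 3 \<and> answer n \<sigma>' = M *\<^sub>v w) \<tau>"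
    using \<tau> i w answer by (intro wp_scan) auto
  show "wp W scan (\<lambda>u. wp W (Op roundR Add (Reg roundR) (Const 1))
    (\<lambda>v \<sigma>'. t + (u + v) \<le> 25 * (n * (1 + ?J)) \<and> ready (Suc i) \<sigma>' \<and> answer n \<sigma>' = M *\<^sub>v w)) \<tau>"
  proof (rule wp_conseq[OF scan], elim conjE)
    fix u \<sigma>'
    assume u: "u \<le> n * 13 + ?J * (n * 9 + 2) + 3" and answer': "answer n \<sigma>' = M *\<^sub>v w"
      and unwritten': "unwritten_eq scan \<tau> \<sigma>'"
    have "?J \<le> n * ?J" using n_ge by simp
    moreover have "25 * (n * (1 + ?J)) = 25 * n + 25 * (n * ?J)"
      "?J * (n * 9 + 2) = 9 * (n * ?J) + 2 * ?J"
      by (simp_all add: algebra_simps)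
    ultimately have "t + (u + 1) \<le> 25 * (n * (1 + ?J))"
      using t u n_ge by linarith
    moreover have "ready i \<sigma>'"
      using b_ge by (intro ready_unwritten[OF \<tau>(1) unwritten']) auto
    moreover have "int i + 1 \<le> W"
      using i word_bounds by linarith
    ultimately show "wp W (Op roundR Add (Reg roundR) (Const 1))
      (\<lambda>v \<rho>. t + (u + v) \<le> 25 * (n * (1 + ?J)) \<and> ready (Suc i) \<rho> \<and> answer n \<rho> = M *\<^sub>v w) \<sigma>'"
      using answer' by (auto simp: ready_def tables_def answer_def)
  qed
qed

lemma bool_mult_mat_vec_eq:
  assumes w: "w \<in> bit_vecs n"
  shows "bool_mult_mat_vec M w = vec n (\<lambda>a. of_bool (0 < (M *\<^sub>v w) $ a))"
proof (rule eq_vecI)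
  fix a assume "a < dim_vec (vec n (\<lambda>a. of_bool (0 < (M *\<^sub>v w) $ a)) :: int vec)"
  then have a: "a < n" by simp
  have dim: "dim_vec w = n"
    using w by (auto simp: bit_vecs_def)
  have bit: "0 \<le> M $$ (a, j) * w $ j" "M $$ (a, j) * w $ j \<noteq> 0 \<longleftrightarrow> M $$ (a, j) = 1 \<and> w $ j = 1"
    if "j < n" for j
  proof -
    have "w $ j \<in> {0, 1}" using w that by (auto simp: bit_vecs_def)
    then show "0 \<le> M $$ (a, j) * w $ j" "M $$ (a, j) * w $ j \<noteq> 0 \<longleftrightarrow> M $$ (a, j) = 1 \<and> w $ j = 1"
      using M_entry[OF a that] by auto
  qed
  have "0 < (M *\<^sub>v w) $ a \<longleftrightarrow> (\<Sum>j<n. M $$ (a, j) * w $ j) \<noteq> 0"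
    using mult_mat_vec_index_sum[of a M w] a dim sum_nonneg[of "{..<n}" "\<lambda>j. M $$ (a, j) * w $ j"] bit(1)
    by fastforce
  also have "\<dots> \<longleftrightarrow> (\<exists>j<n. M $$ (a, j) * w $ j \<noteq> 0)"
    using bit(1) by (subst sum_nonneg_eq_0_iff) auto
  also have "\<dots> \<longleftrightarrow> (\<exists>j<n. M $$ (a, j) = 1 \<and> w $ j = 1)"
    using bit(2) by blast
  finally show "bool_mult_mat_vec M w $ a = vec n (\<lambda>a. of_bool (0 < (M *\<^sub>v w) $ a)) $ a"
    using a dim by (simp add: bool_mult_mat_vec_def)
qed (simp add: bool_mult_mat_vec_def)

lemma wp_booleanise:
  assumes "reg \<sigma> dimR = int n" and w: "w \<in> bit_vecs n" and answer: "answer n \<sigma> = M *\<^sub>v w"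
  shows "wp W booleanise (\<lambda>t \<sigma>'. t \<le> n * 5 + 2 \<and> answer n \<sigma>' = bool_mult_mat_vec M w) \<sigma>"
proof -
  have "wp W booleanise (\<lambda>t \<sigma>'. t \<le> n * (2 + 3) + 2 \<and>
      answer n \<sigma>' = vec n (\<lambda>a. of_bool (0 < (M *\<^sub>v w) $ a))) \<sigma>"
    unfolding booleanise_def
  proof (rule wp_update_answer, goal_cases step)
    case (step a \<tau>)
    then show ?case
      using mult_bit_vec_bound[OF w, of a] answer word_bounds by (simp del: index_mult_mat_vec)
  qed (use assms word_bounds in auto)
  then show ?thesis
    by (simp add: bool_mult_mat_vec_eq[OF w])
qed

lemma wp_round:
  assumes \<sigma>: "ready i \<sigma>" and i: "i < n" and w: "w \<in> bit_vecs n"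
  shows "wp W query (\<lambda>t \<sigma>'. t \<le> 25 * (n * (1 + jumps 0 (list_of_vec (w - pred i)))) \<and>
    ready (Suc i) \<sigma>' \<and> answer n \<sigma>' = M *\<^sub>v w) (deliver n w \<sigma>)"
proof (rule wp_query)
  show "ready i (deliver n w \<sigma>)"
    using \<sigma> b_ge by (simp add: ready_def tables_def deliver_def)
qed (use i w in \<open>auto simp: deliver_def\<close>)

lemma wp_round_bool:
  assumes \<sigma>: "ready i \<sigma>" and i: "i < n" and w: "w \<in> bit_vecs n"
  shows "wp W (query ;; booleanise) (\<lambda>t \<sigma>'. t \<le> 32 * (n * (1 + jumps 0 (list_of_vec (w - pred i)))) \<and>
    ready (Suc i) \<sigma>' \<and> answer n \<sigma>' = bool_mult_mat_vec M w) (deliver n w \<sigma>)"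
  unfolding wp_Seq
proof (rule wp_conseq[OF wp_round[OF assms]], elim conjE)
  let ?N = "n * (1 + jumps 0 (list_of_vec (w - pred i)))"
  fix t \<sigma>'
  assume t: "t \<le> 25 * ?N" and \<sigma>': "ready (Suc i) \<sigma>'" "answer n \<sigma>' = M *\<^sub>v w"
  have "n \<le> ?N" by simp
  then have time: "t + u \<le> 32 * ?N" if "u \<le> n * 5 + 2" for u
    using t that n_ge by linarith
  have "reg \<sigma>' dimR = int n"
    using \<sigma>'(1) by (simp add: ready_def tables_def)
  then show "wp W booleanise (\<lambda>u \<tau>. t + u \<le> 32 * ?N \<and> ready (Suc i) \<tau> \<and>
      answer n \<tau> = bool_mult_mat_vec M w) \<sigma>'"
    using \<sigma>' w time b_ge
    by (intro wp_conseq[OF wp_booleanise]) (auto intro: ready_unwritten)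
qed

lemma time_jumps_le_EH:
  assumes i: "i < n" and w: "w \<in> bit_vecs n" and C: "64 \<le> C"
    and t: "t \<le> 32 * (n * (1 + jumps 0 (list_of_vec (w - pred i))))"
  shows "real t \<le> C * (real n * (1 + real_of_int (EH (list_of_vec (pred i)) (list_of_vec w))))"
proof -
  let ?J = "jumps 0 (list_of_vec (w - pred i))" and ?E = "EH (list_of_vec (pred i)) (list_of_vec w)"
  have J: "int ?J \<le> 2 * ?E"
    using pred_bits[OF i] w by (rule jumps_diff_le_twice_EH)
  have "real t \<le> real (32 * (n * (1 + ?J)))"
    using t by (rule of_nat_mono)
  also have "\<dots> = 32 * (real n * (1 + real ?J))"
    by (simp add: algebra_simps)
  also have "\<dots> \<le> 32 * (real n * (2 * (1 + real_of_int ?E)))"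
    using J by (intro mult_left_mono) auto
  also have "\<dots> = 64 * (real n * (1 + real_of_int ?E))"
    by simp
  also have "\<dots> \<le> C * (real n * (1 + real_of_int ?E))"
    using C J by (intro mult_right_mono) auto
  finally show ?thesis .
qed

end

section \<open>Online matrix-vector multiplication\<close>

lemma ex_invariant_run:
  assumes "I 0 s" and "\<And>i s. i < n \<Longrightarrow> I i s \<Longrightarrow> \<exists>x s'. step i s x s' \<and> I (Suc i) s'"
  shows "\<exists>x \<sigma>. \<sigma> 0 = s \<and> (\<forall>i<n. step i (\<sigma> i) (x i) (\<sigma> (Suc i)))"
proof -
  have "\<exists>x \<sigma>. \<sigma> 0 = s \<and> (\<forall>i<m. step i (\<sigma> i) (x i) (\<sigma> (Suc i))) \<and> I m (\<sigma> m)" if "m \<le> n" for m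
    using that
  proof (induction m)
    case 0
    then show ?case using assms(1) by auto
  next
    case (Suc m)
    then obtain x \<sigma> where run: "\<sigma> 0 = s" "\<forall>i<m. step i (\<sigma> i) (x i) (\<sigma> (Suc i))" "I m (\<sigma> m)"
      by auto
    then obtain y s' where "step m (\<sigma> m) y s'" "I (Suc m) s'"
      using assms(2) Suc.prems by (meson Suc_le_eq)
    with run show ?case
      by (intro exI[of _ "x(m := y)"] exI[of _ "\<sigma>(Suc m := s')"]) (auto simp: less_Suc_eq)
  qed
  then show ?thesis by blast
qed

lemma omv_with_predictionsI:
  assumes C: "0 \<le> C"
    and preprocess: "\<And>n M v'. 1 \<le> n \<Longrightarrow> M \<in> bit_mats n \<Longrightarrow> \<forall>i<n. v' i \<in> bit_vecs n \<Longrightarrow>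
      wp (word_bound k n) P (\<lambda>t \<sigma>. real t \<le> C * real n powr \<tau> \<and> R n M v' 0 \<sigma>)
        (init_state n (\<lambda>i j. M $$ (i, j)) (\<lambda>i j. v' i $ j))"
    and round: "\<And>n M v' i w \<sigma>. 1 \<le> n \<Longrightarrow> M \<in> bit_mats n \<Longrightarrow> \<forall>i<n. v' i \<in> bit_vecs n \<Longrightarrow>
      i < n \<Longrightarrow> w \<in> bit_vecs n \<Longrightarrow> R n M v' i \<sigma> \<Longrightarrow>
      wp (word_bound k n) Q (\<lambda>t \<sigma>'.
        real t \<le> C * (real n * (1 + real_of_int (EH (list_of_vec (v' i)) (list_of_vec w)))) \<and>
        R n M v' (Suc i) \<sigma>' \<and> answer n \<sigma>' = prd M w) (deliver n w \<sigma>)"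
  shows "omv_with_predictions prd \<tau> P Q k C"
  unfolding omv_with_predictions_def
proof (intro allI ballI impI)
  fix n M and v' :: "nat \<Rightarrow> int vec"
  assume inputs: "1 \<le> n" "M \<in> bit_mats n" "\<forall>i<n. v' i \<in> bit_vecs n"
  let ?W = "word_bound k n" and ?EH = "\<lambda>i w. real_of_int (EH (list_of_vec (v' i)) (list_of_vec w))"
  obtain t0 \<sigma>0 where
    start: "exec ?W P (init_state n (\<lambda>i j. M $$ (i, j)) (\<lambda>i j. v' i $ j)) t0 \<sigma>0"
      "real t0 \<le> C * real n powr \<tau>" "R n M v' 0 \<sigma>0"
    using preprocess[OF inputs] unfolding wp_def by blast
  have "\<exists>t \<sigma>. \<sigma> 0 = \<sigma>0 \<and> (\<forall>i<n. exec ?W Q (deliver n (v i) (\<sigma> i)) (t i) (\<sigma> (Suc i)) \<and>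
      real (t i) \<le> C * (real n * (1 + \<Delta>)) \<and> answer n (\<sigma> (Suc i)) = prd M (v i))"
    if v: "\<forall>i<n. v i \<in> bit_vecs n \<and> ?EH i (v i) \<le> \<Delta>" for \<Delta> v
  proof (rule ex_invariant_run[where I = "R n M v'"])
    fix i \<sigma> assume i: "i < n" "R n M v' i \<sigma>"
    then obtain t \<sigma>' where run: "exec ?W Q (deliver n (v i) \<sigma>) t \<sigma>'" "R n M v' (Suc i) \<sigma>'"
      "answer n \<sigma>' = prd M (v i)" and t: "real t \<le> C * (real n * (1 + ?EH i (v i)))"
      using round[OF inputs i(1) _ i(2), of "v i"] v unfolding wp_def by blast
    note t
    also have "C * (real n * (1 + ?EH i (v i))) \<le> C * (real n * (1 + \<Delta>))"
      using C v i(1) by (intro mult_left_mono) auto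
    finally show "\<exists>t \<sigma>'. (exec ?W Q (deliver n (v i) \<sigma>) t \<sigma>' \<and> real t \<le> C * (real n * (1 + \<Delta>)) \<and>
      answer n \<sigma>' = prd M (v i)) \<and> R n M v' (Suc i) \<sigma>'"
      using run by blast
  qed (rule start(3))
  with start(1,2) show "\<exists>t0 \<sigma>0.
    exec ?W P (init_state n (\<lambda>i j. M $$ (i, j)) (\<lambda>i j. v' i $ j)) t0 \<sigma>0 \<and>
    real t0 \<le> C * real n powr \<tau> \<and>
    (\<forall>\<Delta> v. 0 \<le> \<Delta> \<and> \<Delta> \<le> real n \<and> (\<forall>i<n. v i \<in> bit_vecs n \<and> ?EH i (v i) \<le> \<Delta>) \<longrightarrow>
      (\<exists>t \<sigma>. \<sigma> 0 = \<sigma>0 \<and> (\<forall>i<n. exec ?W Q (deliver n (v i) (\<sigma> i)) (t i) (\<sigma> (Suc i)) \<and>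
        real (t i) \<le> C * (real n * (1 + \<Delta>)) \<and> answer n (\<sigma> (Suc i)) = prd M (v i))))"
    by blast
qed

lemma ex_omv_with_predictions:
  assumes "mat_mult_time \<tau>" "\<tau> \<le> \<tau>'"
  shows "\<exists>P Q R k C. omv_with_predictions (*\<^sub>v) \<tau>' P Q k C \<and>
    omv_with_predictions bool_mult_mat_vec \<tau>' P R k C"
proof -
  obtain c k C where prog: "mat_mult_program 0 \<tau> c k C"
    using assms(1) unfolding mat_mult_time_iff by blast
  obtain m where "\<And>x. x \<in> names c \<Longrightarrow> x < m"
    using finite_names[of c] unfolding finite_nat_set_iff_bounded by blast
  then obtain b where b: "names c \<subseteq> {..<b}" "5 \<le> b"
    by (intro that[of "max m 5"]) fastforce+
  interpret registers b .
  let ?k = "max k 2" and ?C = "\<bar>C\<bar> + 64"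
  have omv_instance: "omv b n (word_bound ?k n) M v'"
    if "1 \<le> n" "M \<in> bit_mats n" "\<forall>i<n. v' i \<in> bit_vecs n" for n M v'
    using that b(2) by unfold_locales (auto intro: word_bound_mono)
  have word: "word_bound k n \<le> word_bound ?k n" for n
    by (intro word_bound_mono) simp
  note tables = omv.wp_preprocess_powr[OF omv_instance prog b(1) word mat_mult_time_ge_2[OF assms(1)] assms(2)]
  have omv: "omv_with_predictions prd \<tau>' (build_tables ;; c) Q ?k ?C"
    if answers: "\<And>n M v' i w \<sigma>. omv b n (word_bound ?k n) M v' \<Longrightarrow> omv.ready b n M v' i \<sigma> \<Longrightarrow>
      i < n \<Longrightarrow> w \<in> bit_vecs n \<Longrightarrow>
      wp (word_bound ?k n) Q (\<lambda>t \<sigma>'. t \<le> 32 * (n * (1 + jumps 0 (list_of_vec (w - v' i)))) \<and>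
        omv.ready b n M v' (Suc i) \<sigma>' \<and> answer n \<sigma>' = prd M w) (deliver n w \<sigma>)" for prd Q
  proof (rule omv_with_predictionsI[where R = "omv.ready b"], goal_cases nonneg preprocess round)
    case (preprocess n M v')
    then show ?case by (rule tables)
  next
    case (round n M v' i w \<sigma>)
    interpret omv b n "word_bound ?k n" M v' using round by (intro omv_instance)
    show ?case
      by (rule wp_conseq[OF answers[OF omv_axioms round(6,4,5)]])
        (use time_jumps_le_EH[OF round(4,5), of ?C] in auto)
  qed simp
  have "omv_with_predictions (*\<^sub>v) \<tau>' (build_tables ;; c) query ?k ?C"
    by (rule omv, rule wp_conseq[OF omv.wp_round]) auto
  moreover have "omv_with_predictions bool_mult_mat_vec \<tau>' (build_tables ;; c) (query ;; booleanise) ?k ?C"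
    by (rule omv, rule omv.wp_round_bool)
  ultimately show ?thesis by blast
qed

theorem theorem2p5:
  shows "(\<forall>\<epsilon>>0. \<exists>P Q R k C.
            omv_with_predictions (*\<^sub>v) (omega + \<epsilon>) P Q k C \<and>
            omv_with_predictions bool_mult_mat_vec (omega + \<epsilon>) P R k C) \<and>
         (mat_mult_time omega \<longrightarrow> (\<exists>P Q R k C.
            omv_with_predictions (*\<^sub>v) omega P Q k C \<and>
            omv_with_predictions bool_mult_mat_vec omega P R k C))"
proof (intro conjI allI impI)
  fix \<epsilon> :: real
  assume "0 < \<epsilon>"
  have nonempty: "{\<tau>. mat_mult_time \<tau>} \<noteq> {}"
    using naive_mult_program unfolding mat_mult_time_iff by blast
  have "Inf {\<tau>. mat_mult_time \<tau>} < omega + \<epsilon>"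
    using \<open>0 < \<epsilon>\<close> by (simp add: omega_def)
  from cInf_lessD[OF nonempty this] obtain \<tau> where "mat_mult_time \<tau>" "\<tau> < omega + \<epsilon>"
    by blast
  then show "\<exists>P Q R k C. omv_with_predictions (*\<^sub>v) (omega + \<epsilon>) P Q k C \<and>
      omv_with_predictions bool_mult_mat_vec (omega + \<epsilon>) P R k C"
    by (intro ex_omv_with_predictions) auto
next
  assume "mat_mult_time omega"
  then show "\<exists>P Q R k C. omv_with_predictions (*\<^sub>v) omega P Q k C \<and>
      omv_with_predictions bool_mult_mat_vec omega P R k C"
    by (rule ex_omv_with_predictions[OF _ order_refl])
qed

end
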